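(* Let $f$ be $L_f$-Lipschitz continuous on its domain, i.e., $|f(x)-f(\hat x)|\le L_f\|x-\hat x\|$ for all $x,\hat x\in\mathrm{dom}(f)$, and assume that the problem $\min_{y\in\mathbb{R}^{p_2}}\{F(y):=f(By)+g(y)\}$ has an optimal solution $y^\star$. (a) Let $\{\bar y^k\}$ be the sequence generated by Scheme 1 described in the context, with $\rho_0>0$. Then $$F(\bar y^k)-F(y^\star)\le\frac{2\rho_0^2\|B\|^2\|\bar y^0-y^\star\|^2+2L_f^2}{\rho_0k}.$$ (b) Assume additionally that $g$ is $\mu_g$-strongly convex with $\mu_g>0$. Then the sequence $\{\bar y^k\}$ generated by Scheme 2 described in the context, with $\rho_0\in\big(0,\frac{\mu_g}{4\|B\|^2}\big]$, satisfies $$F(\bar y^k)-F(y^\star)\le\frac{2L_f^2+8\rho_0^2\|B\|^2\|\bar y^0-y^\star\|^2}{\rho_0(k+2)^2}.$$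
   Context: Here $f:\mathbb{R}^n\to\mathbb{R}\cup\{+\infty\}$ and $g:\mathbb{R}^{p_2}\to\mathbb{R}\cup\{+\infty\}$ are proper, closed and convex, and $B:\mathbb{R}^{p_2}\to\mathbb{R}^n$ is linear. The problem is equivalent to $\min_{x,y}\{f(x)+g(y):x-By=0\}$; standing assumption: the Lagrangian $f(x)+g(y)-\langle x-By,\lambda\rangle$ of this reformulation has a saddle point, and its optimal value is finite and attained. Norms are Euclidean, $\|B\|$ is the operator norm, $f^*$ is the Fenchel conjugate of $f$, and $\mathrm{prox}_{\gamma h}(v):=\arg\min_u\{h(u)+\frac1{2\gamma}\|u-v\|^2\}$. A function $g$ is $\mu_g$-strongly convex if $g-\frac{\mu_g}2\|\cdot\|^2$ is convex. Scheme 1. Start with $\bar y^0\in\mathrm{dom}(g)$, $\bar x^0\in\mathrm{dom}(f)$, $\hat y^0:=\bar y^0$, $\hat\lambda^0:=0$. Parameters: $\tau_k:=\frac1{k+1}$, $\rho_k:=\rho_0(k+1)$, $\beta_k:=2\rho_0\|B\|^2(k+1)$, $\eta_k:=\frac{\rho_0}2$. For $k\ge0$: $\breve x^{k+1}:=\mathrm{prox}_{\rho_kf^*}(\hat\lambda^k+\rho_kB\hat y^k)$; $\bar y^{k+1}:=\mathrm{prox}_{g/\beta_k}(\hat y^k-\frac1{\beta_k}B^\top\breve x^{k+1})$; $\bar x^{k+1}:=B\hat y^k+\frac1{\rho_k}(\hat\lambda^k-\breve x^{k+1})$; $\hat y^{k+1}:=\bar y^{k+1}+\frac{(1-\tau_k)\tau_{k+1}}{\tau_k}(\bar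 y^{k+1}-\bar y^k)$; $\hat\lambda^{k+1}:=\hat\lambda^k-\frac{\eta_k}{\tau_k}\big(\bar x^{k+1}-(1-\tau_k)\bar x^k-B(\bar y^{k+1}-(1-\tau_k)\bar y^k)\big)$. Scheme 2. Start with $\bar y^0\in\mathrm{dom}(g)$, $\bar x^0\in\mathrm{dom}(f)$, $\tilde y^0:=\bar y^0$, $\hat\lambda^0:=0$, $\tau_0:=1$. Parameters: $\rho_k:=\frac{\rho_0}{\tau_k^2}$, $\beta_k:=2\rho_k\|B\|^2$, $\eta_k:=\frac{\rho_0}{2\tau_k}$, $\tau_{k+1}:=\frac{\tau_k}2\big(\sqrt{\tau_k^2+4}-\tau_k\big)$. For $k\ge0$: $\hat y^k:=(1-\tau_k)\bar y^k+\tau_k\tilde y^k$; $\breve x^{k+1}:=\mathrm{prox}_{\rho_kf^*}(\hat\lambda^k+\rho_kB\hat y^k)$; $\tilde y^{k+1}:=\mathrm{prox}_{g/(\tau_k\beta_k)}(\tilde y^k-\frac1{\tau_k\beta_k}B^\top\breve x^{k+1})$; $\bar x^{k+1}:=B\hat y^k+\frac1{\rho_k}(\hat\lambda^k-\breve x^{k+1})$; $\bar y^{k+1}:=(1-\tau_k)\bar y^k+\tau_k\tilde y^{k+1}$; $\hat\lambda^{k+1}:=\hat\lambda^k-\frac{\eta_k}{\tau_k}\big(\bar x^{k+1}-(1-\tau_k)\bar x^k\big)+\eta_kB\tilde y^{k+1}$.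
   Formalization: Both bounds are proved for k ≥ 1, B ≠ 0, and iterates with Bȳ^k in dom(f), i.e. F(ȳ^k) finite (automatic if dom(f) = ℝⁿ); otherwise F(ȳ^k) = +∞ and the bound fails, e.g. f the indicator of {0}, B = id, g(y) = (μ/2)(y−1)², ȳ^0 = 0. *)

theory Defs
  imports "HOL-Analysis.Analysis"
begin

section \<open>Extended-real-valued convex functions\<close>

text \<open>
  Functions with values in the reals together with plus infinity are rendered as functions into
  \<^typ>\<open>ereal\<close>; the value minus infinity is excluded by \<open>proper\<close>.
\<close>

definition effdom :: "('a \<Rightarrow> ereal) \<Rightarrow> 'a set" where
  "effdom h = {x. h x < \<infinity>}"

definition proper :: "('a \<Rightarrow> ereal) \<Rightarrow> bool" where
  "proper h \<longleftrightarrow> (\<forall>x. h x \<noteq> -\<infinity>) \<and> effdom h \<noteq> {}"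

definition epi :: "('a \<Rightarrow> ereal) \<Rightarrow> ('a \<times> real) set" where
  "epi h = {(x, t). h x \<le> ereal t}"

definition closed_fun :: "('a::topological_space \<Rightarrow> ereal) \<Rightarrow> bool" where
  "closed_fun h \<longleftrightarrow> closed (epi h)"

definition convex_fun :: "('a::real_vector \<Rightarrow> ereal) \<Rightarrow> bool" where
  "convex_fun h \<longleftrightarrow> convex (epi h)"

definition strongly_convex_fun :: "real \<Rightarrow> ('a::real_normed_vector \<Rightarrow> ereal) \<Rightarrow> bool" where
  "strongly_convex_fun \<mu> h \<longleftrightarrow> convex_fun (\<lambda>x. h x - ereal (\<mu> / 2 * (norm x)\<^sup>2))"

definition lipschitz_on_dom :: "real \<Rightarrow> ('a::real_normed_vector \<Rightarrow> ereal) \<Rightarrow> bool" where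
  "lipschitz_on_dom L h \<longleftrightarrow>
     (\<forall>x\<in>effdom h. \<forall>x'\<in>effdom h. \<bar>h x - h x'\<bar> \<le> ereal (L * norm (x - x')))"

definition fenchel_conj :: "('a::real_inner \<Rightarrow> ereal) \<Rightarrow> 'a \<Rightarrow> ereal" where
  "fenchel_conj h u = (SUP x. ereal (x \<bullet> u) - h x)"

text \<open>
  \<open>prox \<gamma> h\<close> is the proximal operator of \<open>\<gamma>\<close> times \<open>h\<close>. For \<open>\<gamma> > 0\<close> and \<open>h\<close> proper, closed and
  convex the minimizer exists and is unique, so that \<^const>\<open>arg_min\<close> makes no arbitrary choice.
\<close>

definition prox :: "real \<Rightarrow> ('a::real_normed_vector \<Rightarrow> ereal) \<Rightarrow> 'a \<Rightarrow> 'a" where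
  "prox \<gamma> h v = (ARG_MIN (\<lambda>u. h u + ereal (1 / (2 * \<gamma>) * (norm (u - v))\<^sup>2)) u. True)"


section \<open>The composite problem and its constrained reformulation\<close>

definition objective ::
    "('x \<Rightarrow> ereal) \<Rightarrow> ('y \<Rightarrow> ereal) \<Rightarrow> ('y \<Rightarrow> 'x) \<Rightarrow> 'y \<Rightarrow> ereal" where
  "objective f g B y = f (B y) + g y"

definition lagrangian ::
    "('x::real_inner \<Rightarrow> ereal) \<Rightarrow> ('y \<Rightarrow> ereal) \<Rightarrow> ('y \<Rightarrow> 'x) \<Rightarrow> 'x \<Rightarrow> 'y \<Rightarrow> 'x \<Rightarrow> ereal" where
  "lagrangian f g B x y l = f x + g y - ereal ((x - B y) \<bullet> l)"

definition has_saddle_point ::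
    "('x::real_inner \<Rightarrow> ereal) \<Rightarrow> ('y \<Rightarrow> ereal) \<Rightarrow> ('y \<Rightarrow> 'x) \<Rightarrow> bool" where
  "has_saddle_point f g B \<longleftrightarrow>
     (\<exists>xs ys ls. \<forall>x y l.
        lagrangian f g B xs ys l \<le> lagrangian f g B xs ys ls \<and>
        lagrangian f g B xs ys ls \<le> lagrangian f g B x y ls)"

definition constrained_values ::
    "('x::real_vector \<Rightarrow> ereal) \<Rightarrow> ('y \<Rightarrow> ereal) \<Rightarrow> ('y \<Rightarrow> 'x) \<Rightarrow> ereal set" where
  "constrained_values f g B = {f x + g y | x y. x - B y = 0}"

definition optimal_value_finite_attained ::
    "('x::real_vector \<Rightarrow> ereal) \<Rightarrow> ('y \<Rightarrow> ereal) \<Rightarrow> ('y \<Rightarrow> 'x) \<Rightarrow> bool" where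
  "optimal_value_finite_attained f g B \<longleftrightarrow>
     \<bar>Inf (constrained_values f g B)\<bar> \<noteq> \<infinity> \<and>
     Inf (constrained_values f g B) \<in> constrained_values f g B"


section \<open>The two schemes\<close>

text \<open>
  The predicates \<open>scheme1\<close> and \<open>scheme2\<close> say that the given sequences are generated by the
  respective scheme. Naming of the sequences: \<open>xc\<close> is x-breve, \<open>xb\<close> is x-bar, \<open>yb\<close> is y-bar,
  \<open>yh\<close> is y-hat, \<open>yt\<close> is y-tilde and \<open>lh\<close> is lambda-hat. The entry \<open>xc 0\<close> is unconstrained and
  unused. The transpose of \<open>B\<close> is \<^term>\<open>adjoint B\<close> and its operator norm is \<^term>\<open>onorm B\<close>.
  The parameter sequences of the first scheme are \<open>tau1\<close>, \<open>rho1\<close>, \<open>beta1\<close>, \<open>eta1\<close>, those of the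
  second one are \<open>tau2\<close>, \<open>rho2\<close>, \<open>beta2\<close>, \<open>eta2\<close>.
\<close>

definition tau1 :: "nat \<Rightarrow> real" where
  "tau1 k = 1 / (real k + 1)"

definition rho1 :: "real \<Rightarrow> nat \<Rightarrow> real" where
  "rho1 \<rho>0 k = \<rho>0 * (real k + 1)"

definition beta1 :: "real \<Rightarrow> ('y::real_normed_vector \<Rightarrow> 'x::real_normed_vector) \<Rightarrow> nat \<Rightarrow> real" where
  "beta1 \<rho>0 B k = 2 * \<rho>0 * (onorm B)\<^sup>2 * (real k + 1)"

definition eta1 :: "real \<Rightarrow> nat \<Rightarrow> real" where
  "eta1 \<rho>0 k = \<rho>0 / 2"

definition scheme1 ::
    "('x::euclidean_space \<Rightarrow> ereal) \<Rightarrow> ('y::euclidean_space \<Rightarrow> ereal) \<Rightarrow> ('y \<Rightarrow> 'x) \<Rightarrow> real \<Rightarrow>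
     (nat \<Rightarrow> 'x) \<Rightarrow> (nat \<Rightarrow> 'x) \<Rightarrow> (nat \<Rightarrow> 'y) \<Rightarrow> (nat \<Rightarrow> 'y) \<Rightarrow> (nat \<Rightarrow> 'x) \<Rightarrow> bool" where
  "scheme1 f g B \<rho>0 xc xb yb yh lh \<longleftrightarrow>
     yb 0 \<in> effdom g \<and> xb 0 \<in> effdom f \<and> yh 0 = yb 0 \<and> lh 0 = 0 \<and>
     (\<forall>k. let \<tau> = tau1 k; \<tau>' = tau1 (Suc k); \<rho> = rho1 \<rho>0 k; \<beta> = beta1 \<rho>0 B k; \<eta> = eta1 \<rho>0 k in
        xc (Suc k) = prox \<rho> (fenchel_conj f) (lh k + \<rho> *\<^sub>R B (yh k)) \<and>
        yb (Suc k) = prox (1 / \<beta>) g (yh k - (1 / \<beta>) *\<^sub>R adjoint B (xc (Suc k))) \<and>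
        xb (Suc k) = B (yh k) + (1 / \<rho>) *\<^sub>R (lh k - xc (Suc k)) \<and>
        yh (Suc k) = yb (Suc k) + ((1 - \<tau>) * \<tau>' / \<tau>) *\<^sub>R (yb (Suc k) - yb k) \<and>
        lh (Suc k) = lh k - (\<eta> / \<tau>) *\<^sub>R
          (xb (Suc k) - (1 - \<tau>) *\<^sub>R xb k - B (yb (Suc k) - (1 - \<tau>) *\<^sub>R yb k)))"

primrec tau2 :: "nat \<Rightarrow> real" where
  "tau2 0 = 1"
| "tau2 (Suc k) = tau2 k / 2 * (sqrt ((tau2 k)\<^sup>2 + 4) - tau2 k)"

definition rho2 :: "real \<Rightarrow> nat \<Rightarrow> real" where
  "rho2 \<rho>0 k = \<rho>0 / (tau2 k)\<^sup>2"

definition beta2 :: "real \<Rightarrow> ('y::real_normed_vector \<Rightarrow> 'x::real_normed_vector) \<Rightarrow> nat \<Rightarrow> real" where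
  "beta2 \<rho>0 B k = 2 * rho2 \<rho>0 k * (onorm B)\<^sup>2"

definition eta2 :: "real \<Rightarrow> nat \<Rightarrow> real" where
  "eta2 \<rho>0 k = \<rho>0 / (2 * tau2 k)"

definition scheme2 ::
    "('x::euclidean_space \<Rightarrow> ereal) \<Rightarrow> ('y::euclidean_space \<Rightarrow> ereal) \<Rightarrow> ('y \<Rightarrow> 'x) \<Rightarrow> real \<Rightarrow>
     (nat \<Rightarrow> 'x) \<Rightarrow> (nat \<Rightarrow> 'x) \<Rightarrow> (nat \<Rightarrow> 'y) \<Rightarrow> (nat \<Rightarrow> 'y) \<Rightarrow> (nat \<Rightarrow> 'y) \<Rightarrow> (nat \<Rightarrow> 'x) \<Rightarrow> bool" where
  "scheme2 f g B \<rho>0 xc xb yb yh yt lh \<longleftrightarrow>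
     yb 0 \<in> effdom g \<and> xb 0 \<in> effdom f \<and> yt 0 = yb 0 \<and> lh 0 = 0 \<and>
     (\<forall>k. let \<tau> = tau2 k; \<rho> = rho2 \<rho>0 k; \<beta> = beta2 \<rho>0 B k; \<eta> = eta2 \<rho>0 k in
        yh k = (1 - \<tau>) *\<^sub>R yb k + \<tau> *\<^sub>R yt k \<and>
        xc (Suc k) = prox \<rho> (fenchel_conj f) (lh k + \<rho> *\<^sub>R B (yh k)) \<and>
        yt (Suc k) = prox (1 / (\<tau> * \<beta>)) g (yt k - (1 / (\<tau> * \<beta>)) *\<^sub>R adjoint B (xc (Suc k))) \<and>
        xb (Suc k) = B (yh k) + (1 / \<rho>) *\<^sub>R (lh k - xc (Suc k)) \<and>
        yb (Suc k) = (1 - \<tau>) *\<^sub>R yb k + \<tau> *\<^sub>R yt (Suc k) \<and>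
        lh (Suc k) = lh k - (\<eta> / \<tau>) *\<^sub>R (xb (Suc k) - (1 - \<tau>) *\<^sub>R xb k)
          + \<eta> *\<^sub>R B (yt (Suc k)))"

end

theory Submission
  imports Defs
begin

text \<open>
  Both schemes are instances of one iteration with \<open>\<rho>\<^sub>k\<^sub>+\<^sub>1 (1 - \<tau>\<^sub>k\<^sub>+\<^sub>1) = \<rho>\<^sub>k\<close>, \<open>\<tau>\<^sub>0 = 1\<close>, \<open>\<eta>\<^sub>k / \<tau>\<^sub>k = \<rho>\<^sub>k / 2\<close> and
  \<open>\<beta>\<^sub>k = 2 \<rho>\<^sub>k \<parallel>B\<parallel>\<^sup>2\<close>, which the locale \<open>primal_dual_iteration\<close> describes by real-valued inequalities
  only. These inequalities come from the optimality conditions of the two proximal steps; for the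
  first of them, Moreau's identity says that x-breve is a subgradient of \<open>f\<close> at the new x-bar
  (\<open>moreau_prox_subgradient\<close>).

  Let \<open>r\<^sub>k\<close> be the residual of x-bar and y-bar in \<open>x - B y = 0\<close>, and let \<open>E\<^sub>k\<close> be the value
  \<open>f + g\<close> at x-bar and y-bar minus the optimal value. As \<open>\<rho>\<^sub>k\<^sub>+\<^sub>1 (1 - \<tau>\<^sub>k\<^sub>+\<^sub>1) = \<rho>\<^sub>k\<close>, the dual update
  telescopes and the dual variable is a multiple of the residual (\<open>lh_eq\<close>). Substituting this into
  the optimality conditions gives the one-step inequality \<open>descent\<close>, in which the dual variable no
  longer occurs and \<open>E\<close> comes with a multiple \<open>3/4 \<rho>\<close> of the squared residual. Moving from x-bar to
  \<open>B\<close> y-bar costs at most \<open>L \<parallel>r\<^sub>k\<parallel>\<close> by Lipschitz continuity, and this linear term is absorbed by the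
  squared residual (\<open>gap_le_of_potential\<close>).

  For the first scheme the potential is multiplied by \<open>k + 1\<close> and telescopes (\<open>gap_sublinear\<close>).
  For the second scheme it is divided by \<open>\<tau>\<^sub>k\<^sup>2\<close>; the strong convexity of \<open>g\<close> pays for the growth of the
  weight of the distance term (\<open>gap_quadratic\<close>), and the error after \<open>k\<close> steps is at most
  \<open>\<tau>\<^sub>k\<^sub>-\<^sub>1\<^sup>2\<close> times a constant. That yields the claimed constant for \<open>k \<ge> 3\<close>, where
  \<open>\<tau>\<^sub>k\<^sub>-\<^sub>1 (k + 2)\<close> is at most \<open>100/42\<close>, but it is slightly too weak for \<open>k = 1\<close> and \<open>k = 2\<close>.
  In the case \<open>k = 1\<close> it is averaged with a second estimate that compares \<open>f\<close> at \<open>B\<close> y-bar with \<open>f\<close>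
  at the solution directly (\<open>gap_1_le\<close>). In the case \<open>k = 2\<close> the two one-step inequalities are
  added with all the nonnegative terms retained which the general argument drops; they bound the
  residual (\<open>gap_2_le\<close>).
\<close>

section \<open>Subgradients and proximal points\<close>

text \<open>
  \<open>subgradient h p s\<close> says that \<open>s\<close> is a subgradient of \<open>h\<close> at the point \<open>p\<close> of its domain.
\<close>


definition subgradient :: "('a::real_inner \<Rightarrow> ereal) \<Rightarrow> 'a \<Rightarrow> 'a \<Rightarrow> bool" where
  "subgradient h p s \<longleftrightarrow> p \<in> effdom h \<and> (\<forall>x. h p + ereal (s \<bullet> (x - p)) \<le> h x)"

lemma effdom_ereal_real:
  assumes "proper h" "x \<in> effdom h"
  shows "ereal (real_of_ereal (h x)) = h x"
  using assms by (cases "h x") (auto simp: proper_def effdom_def)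

lemma mem_epi_iff:
  assumes "proper h"
  shows "(x, t) \<in> epi h \<longleftrightarrow> x \<in> effdom h \<and> real_of_ereal (h x) \<le> t"
  using assms by (cases "h x") (auto simp: proper_def effdom_def epi_def)

lemma convex_fun_effdom:
  assumes "proper h" "convex_fun h" "x \<in> effdom h" "y \<in> effdom h" "0 \<le> t" "t \<le> 1"
  shows "(1 - t) *\<^sub>R x + t *\<^sub>R y \<in> effdom h"
    and "real_of_ereal (h ((1 - t) *\<^sub>R x + t *\<^sub>R y))
           \<le> (1 - t) * real_of_ereal (h x) + t * real_of_ereal (h y)"
proof -
  have "(x, real_of_ereal (h x)) \<in> epi h" "(y, real_of_ereal (h y)) \<in> epi h"
    using assms by (auto simp: mem_epi_iff)
  then have "(1 - t) *\<^sub>R (x, real_of_ereal (h x)) + t *\<^sub>R (y, real_of_ereal (h y)) \<in> epi h"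
    using assms(2,5,6) unfolding convex_fun_def convex_alt by blast
  then show "(1 - t) *\<^sub>R x + t *\<^sub>R y \<in> effdom h"
    and "real_of_ereal (h ((1 - t) *\<^sub>R x + t *\<^sub>R y))
           \<le> (1 - t) * real_of_ereal (h x) + t * real_of_ereal (h y)"
    using assms(1) by (auto simp: mem_epi_iff)
qed

lemma subgradient_realD:
  assumes "proper h" "subgradient h p s" "x \<in> effdom h"
  shows "real_of_ereal (h p) + s \<bullet> (x - p) \<le> real_of_ereal (h x)"
proof -
  have "ereal (real_of_ereal (h p)) + ereal (s \<bullet> (x - p)) \<le> ereal (real_of_ereal (h x))"
    using assms by (simp add: subgradient_def effdom_ereal_real)
  then show ?thesis by simp
qed

lemma subgradientI_real:
  assumes "proper h" "p \<in> effdom h"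
    and "\<And>x. x \<in> effdom h \<Longrightarrow> real_of_ereal (h p) + s \<bullet> (x - p) \<le> real_of_ereal (h x)"
  shows "subgradient h p s"
  unfolding subgradient_def
proof (intro conjI allI)
  fix x
  show "h p + ereal (s \<bullet> (x - p)) \<le> h x"
  proof (cases "x \<in> effdom h")
    case True
    then have "ereal (real_of_ereal (h p) + s \<bullet> (x - p)) \<le> ereal (real_of_ereal (h x))"
      using assms(3) by simp
    then show ?thesis
      using assms True effdom_ereal_real[of h] by (metis plus_ereal.simps(1))
  next
    case False
    then show ?thesis by (simp add: effdom_def)
  qed
qed (use assms in simp)

text \<open>
  The minorant is obtained by separating the epigraph from a point strictly below the graph.
\<close>

lemma affine_minorant:
  fixes h :: "'a::euclidean_space \<Rightarrow> ereal"
  assumes "proper h" "closed_fun h" "convex_fun h"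
  obtains a c where "\<And>x t. (x, t) \<in> epi h \<Longrightarrow> a \<bullet> x + c \<le> t"
proof -
  obtain x0 where x0: "x0 \<in> effdom h" using assms(1) unfolding proper_def by auto
  define t0 where "t0 = real_of_ereal (h x0)"
  have "(x0, t0 - 1) \<notin> epi h" and in0: "(x0, t0) \<in> epi h"
    using x0 assms(1) by (auto simp: mem_epi_iff t0_def)
  then obtain n b where n: "n \<bullet> (x0, t0 - 1) < b" "\<forall>z\<in>epi h. b < n \<bullet> z"
    using separating_hyperplane_closed_point[of "epi h" "(x0, t0 - 1)"] assms
    unfolding closed_fun_def convex_fun_def by auto
  obtain q \<alpha> where [simp]: "n = (q, \<alpha>)" by (cases n)
  have "\<alpha> * (t0 - 1) < \<alpha> * t0" using n in0 by fastforce
  then have \<alpha>: "\<alpha> > 0" by (simp add: algebra_simps)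
  show ?thesis
  proof
    fix x t assume "(x, t) \<in> epi h"
    then have "b < q \<bullet> x + \<alpha> * t" using n by fastforce
    then have "(b - q \<bullet> x) / \<alpha> < t" using \<alpha> by (simp add: field_simps)
    then show "(- (1 / \<alpha>) *\<^sub>R q) \<bullet> x + b / \<alpha> \<le> t"
      using \<alpha> by (simp add: field_simps)
  qed
qed

lemma norm_sq_add: "(norm (a + b))\<^sup>2 = (norm a)\<^sup>2 + 2 * (a \<bullet> b) + (norm b)\<^sup>2"
  for a b :: "'a::real_inner"
  unfolding power2_norm_eq_inner by (simp add: inner_add inner_commute)

lemma norm_sq_scaleR: "(norm (s *\<^sub>R b))\<^sup>2 = s\<^sup>2 * (norm b)\<^sup>2"
  for b :: "'a::real_inner"
  by (simp add: power_mult_distrib)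

text \<open>
  The optimality condition determines the proximal point: adding the quadratic makes the
  objective exceed its value at \<open>p\<close> by at least a multiple of the squared distance to \<open>p\<close>, so the
  minimizer that \<^const>\<open>arg_min\<close> selects is unique.
\<close>

lemma prox_eqI:
  assumes "subgradient h p ((1 / \<gamma>) *\<^sub>R (v - p))" "h p \<noteq> -\<infinity>" "\<gamma> > 0"
  shows "prox \<gamma> h v = p"
proof -
  define \<Phi> where "\<Phi> u = h u + ereal (1 / (2 * \<gamma>) * (norm (u - v))\<^sup>2)" for u
  have fin: "\<bar>h p\<bar> \<noteq> \<infinity>" using assms by (auto simp: subgradient_def effdom_def)
  then obtain hp where hp: "h p = ereal hp" by (cases "h p") auto
  have less: "\<Phi> p < \<Phi> u" if "u \<noteq> p" for u
  proof -
    have le: "ereal (hp + ((1 / \<gamma>) *\<^sub>R (v - p)) \<bullet> (u - p)) \<le> h u"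
      using assms(1) hp by (simp add: subgradient_def)
    have id: "(norm (u - v))\<^sup>2 = (norm (p - v))\<^sup>2 - 2 * ((v - p) \<bullet> (u - p)) + (norm (u - p))\<^sup>2"
      unfolding power2_norm_eq_inner by (simp add: inner_diff algebra_simps inner_commute)
    have "1 / (2 * \<gamma>) * (norm (p - v))\<^sup>2 
        < ((1 / \<gamma>) *\<^sub>R (v - p)) \<bullet> (u - p) + 1 / (2 * \<gamma>) * (norm (u - v))\<^sup>2"
      unfolding id inner_scaleR_left using \<open>\<gamma> > 0\<close> that by (simp add: field_simps)
    then have "\<Phi> p < ereal (hp + ((1 / \<gamma>) *\<^sub>R (v - p)) \<bullet> (u - p)) + ereal (1 / (2 * \<gamma>) * (norm (u - v))\<^sup>2)"
      by (simp add: \<Phi>_def hp)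
    also have "\<dots> \<le> \<Phi> u" unfolding \<Phi>_def by (intro add_right_mono le)
    finally show ?thesis .
  qed
  have "is_arg_min \<Phi> (\<lambda>u. True) u \<longleftrightarrow> u = p" for u
    unfolding is_arg_min_def using less by (metis less_asym)
  then have "is_arg_min \<Phi> (\<lambda>u. True) = (\<lambda>u. u = p)" by auto
  then show ?thesis unfolding prox_def arg_min_def \<Phi>_def[symmetric] by simp
qed

text \<open>
  A minimizer exists because the affine minorant makes the sublevel set of
  \<open>t + 1 / (2 \<gamma>) \<parallel>u - v\<parallel>\<^sup>2\<close> on the epigraph compact; comparing it with the points of a segment yields
  the optimality condition.
\<close>

lemma prox_subgradient_exists:
  fixes h :: "'a::euclidean_space \<Rightarrow> ereal"
  assumes h: "proper h" "closed_fun h" "convex_fun h" and \<gamma>: "\<gamma> > 0"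
  shows "\<exists>p. subgradient h p ((1 / \<gamma>) *\<^sub>R (v - p))"
proof -
  obtain a c where minor: "\<And>x t. (x, t) \<in> epi h \<Longrightarrow> a \<bullet> x + c \<le> t"
    using affine_minorant[OF h] by blast
  obtain x0 where x0: "x0 \<in> effdom h" using h(1) unfolding proper_def by auto
  define t0 where "t0 = real_of_ereal (h x0)"
  define \<kappa> where "\<kappa> = 1 / (2 * \<gamma>)"
  have \<kappa>: "\<kappa> > 0" "1 / \<gamma> = 2 * \<kappa>" using \<gamma> by (auto simp: \<kappa>_def)
  define \<Psi> where "\<Psi> z = snd z + \<kappa> * (norm (fst z - v))\<^sup>2" for z :: "'a \<times> real"
  define K where "K = epi h \<inter> {z. \<Psi> z \<le> \<Psi> (x0, t0)}"
  have in0: "(x0, t0) \<in> K"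
    using x0 h(1) by (auto simp: mem_epi_iff t0_def K_def)
  have cont: "continuous_on UNIV \<Psi>" unfolding \<Psi>_def by (intro continuous_intros)
  have "closed K"
    unfolding K_def using h(2) cont
    by (intro closed_Int closed_Collect_le) (auto simp: closed_fun_def)
  moreover have "bounded K"
  proof -
    define M where "M = \<bar>\<Psi> (x0, t0) - a \<bullet> v - c\<bar>"
    define r where "r = 1 + (norm a + M) / \<kappa>"
    have M: "0 \<le> M" by (simp add: M_def)
    then have r: "r \<ge> 1" using \<kappa> by (simp add: r_def)
    have *: "norm (x - v) \<le> r \<and> \<bar>t\<bar> \<le> \<bar>\<Psi> (x0, t0)\<bar> + \<bar>a \<bullet> v\<bar> + norm a * r + \<bar>c\<bar>"
      if "(x, t) \<in> K" for x t
    proof -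
      have t: "a \<bullet> x + c \<le> t" using that minor by (auto simp: K_def)
      have P: "t + \<kappa> * (norm (x - v))\<^sup>2 \<le> \<Psi> (x0, t0)"
        using that by (auto simp: K_def \<Psi>_def)
      have cs: "\<bar>a \<bullet> (x - v)\<bar> \<le> norm a * norm (x - v)" by (rule Cauchy_Schwarz_ineq2)
      have ax: "a \<bullet> x = a \<bullet> v + a \<bullet> (x - v)" by (simp add: inner_diff)
      have quad: "\<kappa> * (norm (x - v))\<^sup>2 \<le> norm a * norm (x - v) + M"
        using t P cs ax unfolding M_def by linarith
      have n: "norm (x - v) \<le> r"
      proof (rule ccontr)
        assume "\<not> norm (x - v) \<le> r"
        then have gt: "norm (x - v) > r" by simp
        have "norm a * norm (x - v) + M \<le> (norm a + M) * norm (x - v)"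
          using M r gt mult_left_mono[of 1 "norm (x - v)" M] by (simp add: distrib_right)
        also have "\<dots> = (\<kappa> * (r - 1)) * norm (x - v)" using \<kappa> by (simp add: r_def)
        also have "\<dots> < (\<kappa> * norm (x - v)) * norm (x - v)"
          using gt r \<kappa> by (intro mult_strict_right_mono mult_strict_left_mono) auto
        finally show False using quad by (simp add: power2_eq_square mult.assoc)
      qed
      then have "norm a * norm (x - v) \<le> norm a * r" by (intro mult_left_mono) auto
      moreover have "0 \<le> \<kappa> * (norm (x - v))\<^sup>2" using \<kappa> by simp
      ultimately show ?thesis using n t P cs ax by linarith
    qed
    have "K \<subseteq> cball v r \<times> cball 0 (\<bar>\<Psi> (x0, t0)\<bar> + \<bar>a \<bullet> v\<bar> + norm a * r + \<bar>c\<bar>)"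
      using * by (auto simp: dist_norm norm_minus_commute)
    then show ?thesis
      by (rule bounded_subset[rotated]) (intro bounded_Times bounded_cball)
  qed
  ultimately have "compact K" by (simp add: compact_eq_bounded_closed)
  then obtain z where z: "z \<in> K" "\<And>z'. z' \<in> K \<Longrightarrow> \<Psi> z \<le> \<Psi> z'"
    using continuous_attains_inf[of K \<Psi>] in0 cont continuous_on_subset by blast
  obtain p t where [simp]: "z = (p, t)" by (cases z)
  have zmin: "\<Psi> (p, t) \<le> \<Psi> z'" if "z' \<in> epi h" for z'
  proof (cases "z' \<in> K")
    case False
    then show ?thesis using that z(2)[OF in0] by (auto simp: K_def)
  qed (use z in auto)
  have p: "p \<in> effdom h" "real_of_ereal (h p) \<le> t"
    using z(1) h(1) by (auto simp: K_def mem_epi_iff)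
  have tp: "t = real_of_ereal (h p)"
    using zmin[of "(p, real_of_ereal (h p))"] p h(1) by (auto simp: mem_epi_iff \<Psi>_def)
  have "subgradient h p ((1 / \<gamma>) *\<^sub>R (v - p))"
  proof (rule subgradientI_real[OF h(1) p(1)])
    fix x assume x: "x \<in> effdom h"
    \<comment> \<open>at \<open>p + s (x - p)\<close> the minimized function exceeds its value at \<open>p\<close> by at most \<open>s (A + s C)\<close>\<close>
    define A where "A = real_of_ereal (h x) - real_of_ereal (h p) - 2 * \<kappa> * ((v - p) \<bullet> (x - p))"
    define C where "C = \<kappa> * (norm (x - p))\<^sup>2"
    have C: "0 \<le> A + s * C" if s: "0 < s" "s \<le> 1" for s :: real
    proof -
      define y where "y = (1 - s) *\<^sub>R p + s *\<^sub>R x"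
      have y: "y \<in> effdom h" 
        "real_of_ereal (h y) \<le> (1 - s) * real_of_ereal (h p) + s * real_of_ereal (h x)"
        using convex_fun_effdom[OF h(1,3) p(1) x, of s] s by (auto simp: y_def)
      have yv: "y - v = (p - v) + s *\<^sub>R (x - p)" by (simp add: y_def algebra_simps)
      have ny: "(norm (y - v))\<^sup>2 = (norm (p - v))\<^sup>2 - 2 * s * ((v - p) \<bullet> (x - p)) + s\<^sup>2 * (norm (x - p))\<^sup>2"
        unfolding yv norm_sq_add norm_sq_scaleR by (simp add: inner_diff_left algebra_simps)
      have "\<Psi> (p, t) \<le> \<Psi> (y, real_of_ereal (h y))"
        by (rule zmin) (use y h(1) in \<open>auto simp: mem_epi_iff\<close>)
      then have "real_of_ereal (h p) + \<kappa> * (norm (p - v))\<^sup>2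
          \<le> (1 - s) * real_of_ereal (h p) + s * real_of_ereal (h x) + \<kappa> * (norm (y - v))\<^sup>2"
        using y(2) by (simp add: \<Psi>_def tp)
      moreover have "s * (A + s * C) = (1 - s) * real_of_ereal (h p) + s * real_of_ereal (h x)
          + \<kappa> * (norm (y - v))\<^sup>2 - real_of_ereal (h p) - \<kappa> * (norm (p - v))\<^sup>2"
        unfolding ny A_def C_def by (simp add: algebra_simps power2_eq_square)
      ultimately have "0 \<le> s * (A + s * C)" by simp
      then show ?thesis using s by (simp add: zero_le_mult_iff)
    qed
    have "0 \<le> A"
    proof (rule ccontr)
      assume "\<not> 0 \<le> A"
      define s where "s = min 1 (- A / (2 * (C + 1)))"
      have C0: "0 \<le> C" using \<kappa> by (simp add: C_def)
      have s: "0 < s" "s \<le> 1" "s \<le> - A / (2 * (C + 1))"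
        using \<open>\<not> 0 \<le> A\<close> C0 by (auto simp: s_def divide_neg_pos)
      have "s * C \<le> s * (C + 1)" using s by simp
      also have "\<dots> \<le> - A / 2" using s(3) C0 by (simp add: field_simps)
      finally show False using C[of s] s \<open>\<not> 0 \<le> A\<close> by linarith
    qed
    then show "real_of_ereal (h p) + ((1 / \<gamma>) *\<^sub>R (v - p)) \<bullet> (x - p) \<le> real_of_ereal (h x)"
      by (simp add: A_def \<kappa>(2))
  qed
  then show ?thesis ..
qed

lemma prox_subgradient:
  fixes h :: "'a::euclidean_space \<Rightarrow> ereal"
  assumes "proper h" "closed_fun h" "convex_fun h" "\<gamma> > 0"
  shows "subgradient h (prox \<gamma> h v) ((1 / \<gamma>) *\<^sub>R (v - prox \<gamma> h v))"
proof -
  obtain p where "subgradient h p ((1 / \<gamma>) *\<^sub>R (v - p))"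
    using prox_subgradient_exists[OF assms] by blast
  moreover from this have "prox \<gamma> h v = p"
    using assms by (intro prox_eqI) (auto simp: proper_def)
  ultimately show ?thesis by simp
qed

lemma fenchel_conj_subgradient:
  assumes "proper f" "subgradient f z s"
  shows "fenchel_conj f s = ereal (s \<bullet> z - real_of_ereal (f z))"
    and "subgradient (fenchel_conj f) s z"
proof -
  have fz: "f z = ereal (real_of_ereal (f z))"
    using assms by (simp add: subgradient_def effdom_ereal_real)
  show eq: "fenchel_conj f s = ereal (s \<bullet> z - real_of_ereal (f z))"
    unfolding fenchel_conj_def
  proof (rule antisym)
    show "(SUP x. ereal (x \<bullet> s) - f x) \<le> ereal (s \<bullet> z - real_of_ereal (f z))"
    proof (rule SUP_least)
      fix x
      have "ereal (real_of_ereal (f z) + s \<bullet> (x - z)) \<le> f x"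
        using assms(2) fz unfolding subgradient_def by (metis plus_ereal.simps(1))
      then show "ereal (x \<bullet> s) - f x \<le> ereal (s \<bullet> z - real_of_ereal (f z))"
        by (cases "f x") (auto simp: inner_diff inner_commute)
    qed
    show "ereal (s \<bullet> z - real_of_ereal (f z)) \<le> (SUP x. ereal (x \<bullet> s) - f x)"
      by (rule SUP_upper2[of z]) (use fz in \<open>auto simp: inner_commute intro: order.refl\<close>, metis ereal_minus(1) inner_commute order.refl)
  qed
  show "subgradient (fenchel_conj f) s z"
    unfolding subgradient_def eq
  proof (intro conjI allI)
    show "s \<in> effdom (fenchel_conj f)" by (simp add: effdom_def eq)
    fix u
    have "ereal (s \<bullet> z - real_of_ereal (f z)) + ereal (z \<bullet> (u - s)) = ereal (z \<bullet> u) - f z"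
      by (subst fz) (simp add: inner_diff inner_commute)
    also have "\<dots> \<le> fenchel_conj f u" unfolding fenchel_conj_def by (rule SUP_upper) simp
    finally show "ereal (s \<bullet> z - real_of_ereal (f z)) + ereal (z \<bullet> (u - s)) \<le> fenchel_conj f u" .
  qed
qed

text \<open>
  Moreau's identity: \<open>z\<close>, the proximal point of \<open>f\<close> at \<open>v / \<rho>\<close>, and \<open>v - \<rho> z\<close>, that of the conjugate
  at \<open>v\<close>, determine each other. Working with \<open>z\<close>, one needs neither that the conjugate is proper,
  closed and convex nor the biconjugate theorem.
\<close>

lemma moreau_prox_subgradient:
  fixes f :: "'a::euclidean_space \<Rightarrow> ereal" and v :: 'a
  assumes f: "proper f" "closed_fun f" "convex_fun f" and \<rho>: "\<rho> > 0"
  defines "p \<equiv> prox \<rho> (fenchel_conj f) v"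
  shows "subgradient f ((1 / \<rho>) *\<^sub>R (v - p)) p"
proof -
  define z where "z = prox (1 / \<rho>) f ((1 / \<rho>) *\<^sub>R v)"
  have z: "subgradient f z (v - \<rho> *\<^sub>R z)"
    using prox_subgradient[OF f, of "1 / \<rho>" "(1 / \<rho>) *\<^sub>R v"] \<rho>
    by (simp add: z_def algebra_simps)
  have "p = v - \<rho> *\<^sub>R z"
    unfolding p_def
  proof (rule prox_eqI)
    show "subgradient (fenchel_conj f) (v - \<rho> *\<^sub>R z) ((1 / \<rho>) *\<^sub>R (v - (v - \<rho> *\<^sub>R z)))"
      using fenchel_conj_subgradient(2)[OF f(1) z] \<rho> by simp
    show "fenchel_conj f (v - \<rho> *\<^sub>R z) \<noteq> -\<infinity>"
      using fenchel_conj_subgradient(1)[OF f(1) z] by simp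
  qed (rule \<rho>)
  then show ?thesis using z \<rho> by simp
qed

lemma strongly_convex_fun_real:
  fixes h :: "'a::real_inner \<Rightarrow> ereal"
  assumes h: "proper h" "strongly_convex_fun \<mu> h" "x \<in> effdom h" "y \<in> effdom h"
    and t: "0 \<le> t" "t \<le> 1"
  shows "real_of_ereal (h ((1 - t) *\<^sub>R x + t *\<^sub>R y)) + \<mu> / 2 * (t * (1 - t) * (norm (x - y))\<^sup>2)
           \<le> (1 - t) * real_of_ereal (h x) + t * real_of_ereal (h y)"
proof -
  define h' where "h' x = h x - ereal (\<mu> / 2 * (norm x)\<^sup>2)" for x
  have dom: "effdom h' = effdom h"
  proof -
    have "h' x < \<infinity> \<longleftrightarrow> h x < \<infinity>" for x by (cases "h x") (auto simp: h'_def)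
    then show ?thesis by (simp add: effdom_def)
  qed
  have "h' x \<noteq> -\<infinity>" for x using h(1) by (cases "h x") (auto simp: h'_def proper_def)
  then have pr: "proper h'" using h(1) dom by (simp add: proper_def)
  have r: "real_of_ereal (h' u) = real_of_ereal (h u) - \<mu> / 2 * (norm u)\<^sup>2" if "u \<in> effdom h" for u
    using effdom_ereal_real[OF h(1) that] by (metis h'_def ereal_minus(1) real_of_ereal.simps(1))
  have cv: "convex_fun h'" using h(2) unfolding strongly_convex_fun_def h'_def[abs_def] .
  let ?u = "(1 - t) *\<^sub>R x + t *\<^sub>R y"
  have u: "?u \<in> effdom h" "real_of_ereal (h' ?u) \<le> (1 - t) * real_of_ereal (h' x) + t * real_of_ereal (h' y)"
    using convex_fun_effdom[OF pr cv, of x y t] h t by (auto simp: dom)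
  have id: "(norm ?u)\<^sup>2 = (1 - t) * (norm x)\<^sup>2 + t * (norm y)\<^sup>2 - t * (1 - t) * (norm (x - y))\<^sup>2"
    unfolding power2_norm_eq_inner
    by (simp add: inner_diff inner_add algebra_simps inner_commute power2_eq_square)
  \<comment> \<open>naming \<open>\<mu> / 2\<close> keeps the simplifier from redistributing the fraction\<close>
  obtain m where m: "\<mu> / 2 = m" by blast
  show ?thesis
    using u(2) unfolding r[OF u(1)] r[OF h(3)] r[OF h(4)] id m by (simp add: algebra_simps)
qed

text \<open>
  Strong convexity improves the subgradient inequality by \<open>\<mu> / 2 \<parallel>x - p\<parallel>\<^sup>2\<close>: apply both inequalities at
  \<open>p + t (x - p)\<close>, divide by \<open>t\<close> and let \<open>t\<close> tend to 0.
\<close>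

lemma strongly_convex_subgradient:
  fixes h :: "'a::real_inner \<Rightarrow> ereal"
  assumes h: "proper h" "convex_fun h" "strongly_convex_fun \<mu> h" and s: "subgradient h p s"
    and x: "x \<in> effdom h"
  shows "real_of_ereal (h p) + s \<bullet> (x - p) + \<mu> / 2 * (norm (x - p))\<^sup>2 \<le> real_of_ereal (h x)"
proof -
  have p: "p \<in> effdom h" using s by (simp add: subgradient_def)
  obtain m where m: "\<mu> / 2 = m" by blast
  have *: "real_of_ereal (h p) + s \<bullet> (x - p) + \<mu> / 2 * (1 - t) * (norm (x - p))\<^sup>2 \<le> real_of_ereal (h x)"
    if t: "0 < t" "t < 1" for t
  proof -
    let ?u = "(1 - t) *\<^sub>R p + t *\<^sub>R x"
    have "?u \<in> effdom h" using convex_fun_effdom(1)[OF h(1,2) p x] t by simp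
    then have "real_of_ereal (h p) + s \<bullet> (?u - p) \<le> real_of_ereal (h ?u)"
      using subgradient_realD[OF h(1) s] by simp
    moreover have "s \<bullet> (?u - p) = t * (s \<bullet> (x - p))"
      by (simp add: inner_diff inner_add algebra_simps)
    moreover have "real_of_ereal (h ?u) + \<mu> / 2 * (t * (1 - t) * (norm (p - x))\<^sup>2)
           \<le> (1 - t) * real_of_ereal (h p) + t * real_of_ereal (h x)"
      using strongly_convex_fun_real[OF h(1,3) p x] t by simp
    moreover have "t * (real_of_ereal (h p) + s \<bullet> (x - p) + \<mu> / 2 * (1 - t) * (norm (x - p))\<^sup>2)
        = t * real_of_ereal (h p) + t * (s \<bullet> (x - p)) + \<mu> / 2 * (t * (1 - t) * (norm (p - x))\<^sup>2)"
      unfolding m by (simp add: algebra_simps norm_minus_commute)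
    moreover have "(1 - t) * real_of_ereal (h p) = real_of_ereal (h p) - t * real_of_ereal (h p)"
      by (simp add: algebra_simps)
    ultimately have "t * (real_of_ereal (h p) + s \<bullet> (x - p) + \<mu> / 2 * (1 - t) * (norm (x - p))\<^sup>2)
        \<le> t * real_of_ereal (h x)"
      by linarith
    then show ?thesis using t by simp
  qed
  let ?q = "\<lambda>t. real_of_ereal (h p) + s \<bullet> (x - p) + \<mu> / 2 * (1 - t) * (norm (x - p))\<^sup>2"
  have "(?q \<longlongrightarrow> ?q 0) (at_right 0)"
    by (intro tendsto_intros)
  moreover have "\<forall>\<^sub>F t in at_right 0. ?q t \<le> real_of_ereal (h x)"
    unfolding eventually_at_right_field by (intro exI[of _ 1]) (use * in auto)
  ultimately have "?q 0 \<le> real_of_ereal (h x)"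
    by (rule tendsto_upperbound) simp
  then show ?thesis by simp
qed

section \<open>One step of the common primal-dual iteration\<close>

lemma dual_step_identity:
  fixes R r e :: "'a::real_inner"
  shows "- ((1 / 2) *\<^sub>R R + r + e) \<bullet> (r - R)
    = 3 / 4 * (norm R)\<^sup>2 - 3 / 4 * (norm r)\<^sup>2 + (norm e)\<^sup>2 - (norm (e + (1 / 2) *\<^sub>R (r - R)))\<^sup>2"
  unfolding power2_norm_eq_inner
  by (simp add: inner_diff inner_add inner_commute[of r R] inner_commute[of r e] 
      inner_commute[of R e] algebra_simps)

lemma linear_minus_quadratic_le:
  fixes c l w :: real
  assumes "c > 0"
  shows "l * w - c * w\<^sup>2 \<le> l\<^sup>2 / (4 * c)"
proof -
  have "0 \<le> (l - 2 * c * w)\<^sup>2" by simp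
  then show ?thesis using assms by (simp add: field_simps power2_eq_square)
qed

lemma sum5_sq_le: "(a + b + c + d + e)\<^sup>2 \<le> 5 * (a\<^sup>2 + b\<^sup>2 + c\<^sup>2 + d\<^sup>2 + e\<^sup>2)" for a b c d e :: real
proof -
  have "5 * (a\<^sup>2 + b\<^sup>2 + c\<^sup>2 + d\<^sup>2 + e\<^sup>2) - (a + b + c + d + e)\<^sup>2
      = (a - b)\<^sup>2 + (a - c)\<^sup>2 + (a - d)\<^sup>2 + (a - e)\<^sup>2 + (b - c)\<^sup>2 + (b - d)\<^sup>2 + (b - e)\<^sup>2
        + (c - d)\<^sup>2 + (c - e)\<^sup>2 + (d - e)\<^sup>2"
    by (simp add: power2_eq_square algebra_simps)
  also have "\<dots> \<ge> 0" by simp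
  finally show ?thesis by simp
qed

text \<open>
  The common form of both schemes. Here \<open>\<phi>\<close> and \<open>\<psi>\<close> are the real values of \<open>f\<close> and \<open>g\<close>, \<open>X\<close> is the
  domain of \<open>f\<close> and \<open>ys\<close> is the comparison point, later an optimal solution. Of the second proximal
  step, which differs between the schemes, only its consequence \<open>psi_step\<close> is kept: \<open>\<psi>\<close> at the new
  y-bar is compared with the convex combination of its values at the old y-bar and at \<open>ys\<close>. The
  number \<open>\<delta> k\<close> is the gain from strong convexity in that comparison.
\<close>

locale primal_dual_iteration =
  fixes \<phi> :: "'x::euclidean_space \<Rightarrow> real" and \<psi> :: "'y::euclidean_space \<Rightarrow> real"
    and X :: "'x set" and B :: "'y \<Rightarrow> 'x" and L :: real and ys :: 'y
    and \<tau> \<rho> :: "nat \<Rightarrow> real" and xc xb lh :: "nat \<Rightarrow> 'x" and yb yh :: "nat \<Rightarrow> 'y"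
    and \<delta> :: "nat \<Rightarrow> real"
  assumes linear_B: "linear B"
    and tau_0: "\<tau> 0 = 1" and tau_bounds: "0 \<le> \<tau> k" "\<tau> k \<le> 1"
    and rho_pos: "0 < \<rho> k" and rho_Suc: "\<rho> (Suc k) * (1 - \<tau> (Suc k)) = \<rho> k"
    and L_nonneg: "0 \<le> L"
    and lipschitz: "\<lbrakk>x \<in> X; x' \<in> X\<rbrakk> \<Longrightarrow> \<phi> x - \<phi> x' \<le> L * norm (x - x')"
    and convex_X: "\<lbrakk>x \<in> X; x' \<in> X; 0 \<le> t; t \<le> 1\<rbrakk> \<Longrightarrow> (1 - t) *\<^sub>R x + t *\<^sub>R x' \<in> X"
    and convex_phi: "\<lbrakk>x \<in> X; x' \<in> X; 0 \<le> t; t \<le> 1\<rbrakk> \<Longrightarrow>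
          \<phi> ((1 - t) *\<^sub>R x + t *\<^sub>R x') \<le> (1 - t) * \<phi> x + t * \<phi> x'"
    and xb_mem: "xb k \<in> X" and B_ys_mem: "B ys \<in> X"
    and phi_subgradient: "x \<in> X \<Longrightarrow> \<phi> (xb (Suc k)) + xc (Suc k) \<bullet> (x - xb (Suc k)) \<le> \<phi> x"
    and xb_Suc: "xb (Suc k) = B (yh k) + (1 / \<rho> k) *\<^sub>R (lh k - xc (Suc k))"
    and lh_0: "lh 0 = 0"
    and lh_Suc: "lh (Suc k) = lh k - (\<rho> k / 2) *\<^sub>R
          ((xb (Suc k) - B (yb (Suc k))) - (1 - \<tau> k) *\<^sub>R (xb k - B (yb k)))"
    and psi_step: "\<psi> (yb (Suc k)) + \<delta> k \<le> (1 - \<tau> k) * \<psi> (yb k) + \<tau> k * \<psi> ys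
          + 2 * \<rho> k * (onorm B)\<^sup>2 * ((yh k - yb (Suc k)) \<bullet> (yb (Suc k) - (1 - \<tau> k) *\<^sub>R yb k - \<tau> k *\<^sub>R ys))
          - xc (Suc k) \<bullet> B (yb (Suc k) - (1 - \<tau> k) *\<^sub>R yb k - \<tau> k *\<^sub>R ys)"
begin

text \<open>The residual of the iterates in the constraint \<open>x - B y = 0\<close>.\<close>

definition r :: "nat \<Rightarrow> 'x" where "r k = xb k - B (yb k)"

text \<open>
  The error in the objective of the constrained problem; it may be negative, since the iterates need
  not satisfy the constraint.
\<close>

definition E :: "nat \<Rightarrow> real" where "E k = \<phi> (xb k) + \<psi> (yb k) - (\<phi> (B ys) + \<psi> ys)"

text \<open>The error in the composite objective, meaningful if \<open>B (yb k)\<close> is in the domain \<open>X\<close>.\<close>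

definition gap :: "nat \<Rightarrow> real" where "gap k = \<phi> (B (yb k)) + \<psi> (yb k) - (\<phi> (B ys) + \<psi> ys)"

text \<open>
  The difference of y-hat from the convex combination of the current y-bar and \<open>ys\<close>; for \<open>\<tau> k > 0\<close> it is
  \<open>\<tau> k\<close> times the distance vector of the auxiliary point y-tilde to \<open>ys\<close>.
\<close>

definition U :: "nat \<Rightarrow> 'y" where "U k = yh k - (1 - \<tau> k) *\<^sub>R yb k - \<tau> k *\<^sub>R ys"

text \<open>The corresponding difference for the new y-bar.\<close>

definition V :: "nat \<Rightarrow> 'y" where "V k = yb (Suc k) - (1 - \<tau> k) *\<^sub>R yb k - \<tau> k *\<^sub>R ys"

lemma norm_B_le: "(norm (B y))\<^sup>2 \<le> (onorm B)\<^sup>2 * (norm y)\<^sup>2"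
proof -
  have "norm (B y) \<le> onorm B * norm y"
    using onorm[of B] linear_B by (simp add: linear_conv_bounded_linear)
  then have "(norm (B y))\<^sup>2 \<le> (onorm B * norm y)\<^sup>2" by (intro power_mono) auto
  then show ?thesis by (simp add: power_mult_distrib)
qed

lemma B_lin: "B (x + y) = B x + B y" "B (x - y) = B x - B y" "B (c *\<^sub>R x) = c *\<^sub>R B x"
  using linear_B by (auto simp: linear_add linear_diff linear_scale)

text \<open>
  The dual variable is a multiple of the residual. At \<open>k = 0\<close> both sides vanish, as \<open>\<tau> 0 = 1\<close>.
\<close>

lemma lh_eq: "lh k = - (\<rho> k / 2 * (1 - \<tau> k)) *\<^sub>R r k"
proof (induction k)
  case 0
  then show ?case by (simp add: tau_0 lh_0)
next
  case (Suc k)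
  have "lh (Suc k) = lh k - (\<rho> k / 2) *\<^sub>R (r (Suc k) - (1 - \<tau> k) *\<^sub>R r k)"
    unfolding r_def by (rule lh_Suc)
  also have "\<dots> = - (\<rho> k / 2) *\<^sub>R r (Suc k)"
  proof -
    obtain h where "\<rho> k / 2 = h" by blast
    then show ?thesis unfolding Suc by (simp add: algebra_simps)
  qed
  also have "\<rho> k / 2 = \<rho> (Suc k) / 2 * (1 - \<tau> (Suc k))" by (simp add: rho_Suc)
  finally show ?case .
qed

lemma xc_eq: "xc (Suc k) = - \<rho> k *\<^sub>R ((1 / 2) *\<^sub>R ((1 - \<tau> k) *\<^sub>R r k) + r (Suc k) + B (V k - U k))"
proof -
  have "\<rho> k *\<^sub>R (xb (Suc k) - B (yh k)) = lh k - xc (Suc k)"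
    using rho_pos[of k] by (simp add: xb_Suc)
  then have "xc (Suc k) = lh k - \<rho> k *\<^sub>R (xb (Suc k) - B (yh k))" by simp
  also have "xb (Suc k) - B (yh k) = r (Suc k) + B (V k - U k)"
    by (simp add: r_def U_def V_def B_lin)
  finally have "xc (Suc k) = lh k - \<rho> k *\<^sub>R (r (Suc k) + B (V k - U k))" .
  moreover obtain h where "\<rho> k = 2 * h" by (metis field_sum_of_halves mult_2)
  ultimately show ?thesis unfolding lh_eq by (simp add: algebra_simps)
qed

lemma psi_step':
  "\<psi> (yb (Suc k)) + \<delta> k \<le> (1 - \<tau> k) * \<psi> (yb k) + \<tau> k * \<psi> ys
     + \<rho> k * (onorm B)\<^sup>2 * ((norm (U k))\<^sup>2 - (norm (V k))\<^sup>2 - (norm (V k - U k))\<^sup>2)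
     - xc (Suc k) \<bullet> B (V k)"
proof -
  have "(norm (U k))\<^sup>2 - (norm (V k))\<^sup>2 - (norm (V k - U k))\<^sup>2 = 2 * ((U k - V k) \<bullet> V k)"
    unfolding power2_norm_eq_inner by (simp add: inner_diff inner_commute)
  moreover have "U k - V k = yh k - yb (Suc k)" by (simp add: U_def V_def)
  ultimately have eq: "(norm (U k))\<^sup>2 - (norm (V k))\<^sup>2 - (norm (V k - U k))\<^sup>2
      = 2 * ((yh k - yb (Suc k)) \<bullet> V k)" by simp
  show ?thesis
    unfolding eq using psi_step[of k, folded V_def] by (simp add: mult.assoc mult.left_commute)
qed

text \<open>
  The one-step inequality. The subgradient inequality of \<open>\<phi>\<close> and \<open>psi_step\<close> are added; the dual
  variable enters only through \<open>xc_eq\<close>, and \<open>dual_step_identity\<close> completes the square.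
\<close>

lemma descent:
  "E (Suc k) + 3 / 4 * \<rho> k * (norm (r (Suc k)))\<^sup>2 + \<rho> k * (onorm B)\<^sup>2 * (norm (V k))\<^sup>2
     + \<rho> k * (norm (B (V k - U k) + (1 / 2) *\<^sub>R (r (Suc k) - (1 - \<tau> k) *\<^sub>R r k)))\<^sup>2 + \<delta> k
   \<le> (1 - \<tau> k) * E k + 3 / 4 * \<rho> k * (norm ((1 - \<tau> k) *\<^sub>R r k))\<^sup>2
     + \<rho> k * (onorm B)\<^sup>2 * (norm (U k))\<^sup>2"
proof -
  define R where "R = (1 - \<tau> k) *\<^sub>R r k"
  define e where "e = B (V k - U k)"
  let ?x = "(1 - \<tau> k) *\<^sub>R xb k + \<tau> k *\<^sub>R B ys"
  have t: "0 \<le> \<tau> k" "\<tau> k \<le> 1" by (rule tau_bounds)+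
  have "\<phi> (xb (Suc k)) + xc (Suc k) \<bullet> (?x - xb (Suc k)) \<le> \<phi> ?x"
    using convex_X[OF xb_mem B_ys_mem t] by (rule phi_subgradient)
  also have "\<dots> \<le> (1 - \<tau> k) * \<phi> (xb k) + \<tau> k * \<phi> (B ys)"
    using convex_phi[OF xb_mem B_ys_mem t] .
  also have "?x - xb (Suc k) = - (r (Suc k) - R + B (V k))"
    by (simp add: R_def r_def V_def B_lin algebra_simps)
  finally have 1: "\<phi> (xb (Suc k)) - xc (Suc k) \<bullet> (r (Suc k) - R) - xc (Suc k) \<bullet> B (V k)
      \<le> (1 - \<tau> k) * \<phi> (xb k) + \<tau> k * \<phi> (B ys)"
    by (simp add: inner_add inner_diff)
  have "xc (Suc k) \<bullet> (r (Suc k) - R) = \<rho> k * (- ((1 / 2) *\<^sub>R R + r (Suc k) + e) \<bullet> (r (Suc k) - R))"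
    unfolding xc_eq R_def[symmetric] e_def[symmetric]
    by (simp only: inner_scaleR_left inner_minus_left mult_minus_left mult_minus_right)
  also have "\<dots> = \<rho> k * (3 / 4 * (norm R)\<^sup>2 - 3 / 4 * (norm (r (Suc k)))\<^sup>2 + (norm e)\<^sup>2
      - (norm (e + (1 / 2) *\<^sub>R (r (Suc k) - R)))\<^sup>2)"
    unfolding dual_step_identity ..
  finally have 2: "xc (Suc k) \<bullet> (r (Suc k) - R) = 3 / 4 * \<rho> k * (norm R)\<^sup>2 
      - 3 / 4 * \<rho> k * (norm (r (Suc k)))\<^sup>2 + \<rho> k * (norm e)\<^sup>2
      - \<rho> k * (norm (e + (1 / 2) *\<^sub>R (r (Suc k) - R)))\<^sup>2"
    by (simp add: algebra_simps)
  have "\<rho> k * (norm e)\<^sup>2 \<le> \<rho> k * ((onorm B)\<^sup>2 * (norm (V k - U k))\<^sup>2)"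
    unfolding e_def using rho_pos[of k] by (intro mult_left_mono norm_B_le) auto
  moreover have "\<rho> k * (onorm B)\<^sup>2 * ((norm (U k))\<^sup>2 - (norm (V k))\<^sup>2 - (norm (V k - U k))\<^sup>2)
     = \<rho> k * (onorm B)\<^sup>2 * (norm (U k))\<^sup>2 - \<rho> k * (onorm B)\<^sup>2 * (norm (V k))\<^sup>2 
       - \<rho> k * ((onorm B)\<^sup>2 * (norm (V k - U k))\<^sup>2)"
    by (simp add: algebra_simps)
  moreover have "(1 - \<tau> k) * E k + \<tau> k * \<phi> (B ys) + \<tau> k * \<psi> ys + (\<phi> (xb (Suc k)) + \<psi> (yb (Suc k)))
     = E (Suc k) + (\<phi> (B ys) + \<psi> ys) + ((1 - \<tau> k) * \<phi> (xb k) + \<tau> k * \<phi> (B ys))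
      + ((1 - \<tau> k) * \<psi> (yb k) + \<tau> k * \<psi> ys) - (1 - \<tau> k) * (\<phi> (B ys) + \<psi> ys)"
    unfolding E_def by (simp add: algebra_simps)
  moreover have "(1 - \<tau> k) * (\<phi> (B ys) + \<psi> ys) = \<phi> (B ys) + \<psi> ys - \<tau> k * \<phi> (B ys) - \<tau> k * \<psi> ys"
    by (simp add: algebra_simps)
  ultimately show ?thesis
    using 1 2 psi_step'[of k] unfolding R_def[symmetric] e_def[symmetric] by linarith
qed

lemma gap_le:
  assumes "B (yb k) \<in> X"
  shows "gap k \<le> E k + L * norm (r k)"
  using lipschitz[OF assms xb_mem[of k]]
  by (simp add: gap_def E_def r_def norm_minus_commute)

lemma gap_le_of_potential:
  assumes "B (yb k) \<in> X" "E k + 3 / 4 * c * (norm (r k))\<^sup>2 \<le> C" "c > 0"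
  shows "gap k \<le> C + L\<^sup>2 / (3 * c)"
  using gap_le[OF assms(1)] linear_minus_quadratic_le[of "3 / 4 * c" L "norm (r k)"] assms(2,3)
  by simp

section \<open>The first two iterates under strong convexity\<close>

text \<open>
  The mean of two estimates of \<open>gap 1\<close>. The first one uses \<open>psi_step\<close> and bounds
  \<open>\<phi> (B (yb 1)) - \<phi> (B ys)\<close> by Lipschitz continuity; the second one is \<open>descent\<close> together with
  \<open>gap_le\<close>. In the mean the inner products of \<open>B (V 0)\<close> with the residual cancel.
\<close>

lemma gap_1_le:
  assumes mem: "B (yb 1) \<in> X"
    and \<delta>: "2 * \<rho> 0 * (onorm B)\<^sup>2 * (norm (V 0))\<^sup>2 \<le> \<delta> 0"
  shows "gap 1 \<le> (2 * L\<^sup>2 + 8 * (\<rho> 0)\<^sup>2 * (onorm B)\<^sup>2 * (norm (U 0))\<^sup>2) / (9 * \<rho> 0)"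
proof -
  define p b a c w where "p = \<rho> 0" and "b = onorm B" and "a = B (U 0)" and "c = B (V 0)" and "w = r 1"
  define D v A W where "D = b * norm (U 0)" and "v = b * norm (V 0)" and "A = norm a" and "W = norm w"
  have p: "p > 0" using rho_pos by (simp add: p_def)
  have b: "b \<ge> 0" unfolding b_def using linear_B
    by (intro onorm_pos_le) (simp add: linear_conv_bounded_linear)
  have xc: "xc 1 = - p *\<^sub>R (w + (c - a))"
    using xc_eq[of 0] by (simp add: tau_0 p_def w_def c_def a_def B_lin)
  have V0: "V 0 = yb 1 - ys" by (simp add: V_def tau_0)
  have cv: "norm c \<le> v"
    unfolding c_def v_def b_def using onorm[of B] linear_B by (simp add: linear_conv_bounded_linear)
  have cross: "(norm (V 0 - U 0))\<^sup>2 = (norm (V 0))\<^sup>2 - 2 * (U 0 \<bullet> V 0) + (norm (U 0))\<^sup>2"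
    unfolding power2_norm_eq_inner by (simp add: inner_diff inner_commute)
  have UV: "b\<^sup>2 * (U 0 \<bullet> V 0) \<le> D * v"
    using mult_left_mono[OF norm_cauchy_schwarz[of "U 0" "V 0"], of "b\<^sup>2"]
    by (simp add: D_def v_def power2_eq_square mult_ac)
  have "\<phi> (B (yb 1)) - \<phi> (B ys) \<le> L * norm c"
    using lipschitz[OF mem B_ys_mem] by (simp add: c_def V0 B_lin)
  moreover have "\<psi> (yb 1) + \<delta> 0 \<le> \<psi> ys
      + p * b\<^sup>2 * ((norm (U 0))\<^sup>2 - (norm (V 0))\<^sup>2 - (norm (V 0 - U 0))\<^sup>2) - xc 1 \<bullet> c"
    using psi_step'[of 0] by (simp add: tau_0 p_def b_def c_def)
  moreover have \<delta>': "2 * p * v\<^sup>2 \<le> \<delta> 0"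
    using \<delta> by (simp add: v_def p_def b_def power_mult_distrib mult.assoc)
  moreover have "p * b\<^sup>2 * ((norm (U 0))\<^sup>2 - (norm (V 0))\<^sup>2 - (norm (V 0 - U 0))\<^sup>2)
      = p * (2 * (b\<^sup>2 * (U 0 \<bullet> V 0))) - 2 * (p * v\<^sup>2)"
    unfolding cross v_def by (simp add: power_mult_distrib right_diff_distrib distrib_left)
  moreover have "xc 1 \<bullet> c = - (p * (w \<bullet> c + c \<bullet> c - a \<bullet> c))"
    unfolding xc by (simp only: inner_scaleR_left inner_add_left inner_diff_left mult_minus_left)
      (simp add: algebra_simps)
  ultimately have "gap 1 \<le> L * norm c + p * (2 * (b\<^sup>2 * (U 0 \<bullet> V 0))) - 4 * (p * v\<^sup>2)
      + p * (w \<bullet> c + c \<bullet> c - a \<bullet> c)"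
    unfolding gap_def by linarith
  then have gA: "gap 1 \<le> L * norm c + p * (2 * (b\<^sup>2 * (U 0 \<bullet> V 0)) - 4 * v\<^sup>2 + (w \<bullet> c + c \<bullet> c - a \<bullet> c))"
    by (simp add: distrib_left right_diff_distrib)
  have e1: "E 1 + 3 / 4 * p * W\<^sup>2 + p * v\<^sup>2 + p * (norm (c - a + (1 / 2) *\<^sub>R w))\<^sup>2 + \<delta> 0 \<le> p * D\<^sup>2"
    using descent[of 0]
    by (simp add: tau_0 p_def W_def w_def v_def D_def b_def c_def a_def B_lin power_mult_distrib mult.assoc)
  have sq: "(norm (c - a + (1 / 2) *\<^sub>R w))\<^sup>2 = c \<bullet> c - 2 * (a \<bullet> c) + A\<^sup>2 + w \<bullet> c - a \<bullet> w + 1 / 4 * W\<^sup>2"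
    unfolding A_def W_def power2_norm_eq_inner
    by (simp add: inner_diff inner_add inner_commute[of c a] inner_commute[of c w]
        inner_commute[of w a] add_divide_distrib diff_divide_distrib)
  have "gap 1 \<le> L * W + p * D\<^sup>2 - 3 / 4 * p * W\<^sup>2 - 3 * (p * v\<^sup>2)
      - p * (c \<bullet> c - 2 * (a \<bullet> c) + A\<^sup>2 + w \<bullet> c - a \<bullet> w + 1 / 4 * W\<^sup>2)"
    using gap_le[OF mem] \<delta>' e1 unfolding sq[symmetric] W_def[symmetric] w_def[symmetric]
    by linarith
  then have gB: "gap 1 \<le> L * W + p * (D\<^sup>2 - W\<^sup>2 - 3 * v\<^sup>2 - (c \<bullet> c - 2 * (a \<bullet> c) + A\<^sup>2 + w \<bullet> c - a \<bullet> w))"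
    by (simp add: algebra_simps)
  have "a \<bullet> c \<le> A * v"
    using norm_cauchy_schwarz[of a c] mult_left_mono[OF cv, of A] by (simp add: A_def)
  moreover have "a \<bullet> w \<le> A * W" using norm_cauchy_schwarz[of a w] by (simp add: A_def W_def)
  ultimately have "2 * (b\<^sup>2 * (U 0 \<bullet> V 0)) - 4 * v\<^sup>2 + (w \<bullet> c + c \<bullet> c - a \<bullet> c)
      + (D\<^sup>2 - W\<^sup>2 - 3 * v\<^sup>2 - (c \<bullet> c - 2 * (a \<bullet> c) + A\<^sup>2 + w \<bullet> c - a \<bullet> w))
    \<le> 2 * D * v - 7 * v\<^sup>2 + D\<^sup>2 + A * v - A\<^sup>2 - W\<^sup>2 + A * W"
    using UV by linarith
  from mult_left_mono[OF this, of p] p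
  have "p * (2 * (b\<^sup>2 * (U 0 \<bullet> V 0)) - 4 * v\<^sup>2 + (w \<bullet> c + c \<bullet> c - a \<bullet> c))
      + p * (D\<^sup>2 - W\<^sup>2 - 3 * v\<^sup>2 - (c \<bullet> c - 2 * (a \<bullet> c) + A\<^sup>2 + w \<bullet> c - a \<bullet> w))
    \<le> p * (2 * D * v - 7 * v\<^sup>2 + D\<^sup>2 + A * v - A\<^sup>2 - W\<^sup>2 + A * W)"
    by (simp only: distrib_left less_imp_le)
  moreover have "L * norm c \<le> L * v" using cv L_nonneg by (rule mult_left_mono)
  ultimately have "2 * gap 1 \<le> p * (2 * D * v - 7 * v\<^sup>2 + D\<^sup>2 + A * v - A\<^sup>2 - W\<^sup>2 + A * W) + L * v + L * W"
    using gA gB by linarith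
  also have "\<dots> = p * (2 * D * v - 7 * v\<^sup>2 + D\<^sup>2 + A * v - A\<^sup>2 - W\<^sup>2 + A * W + L / p * v + L / p * W)"
    using p by (simp add: field_simps)
  also have "\<dots> \<le> p * (16 / 9 * D\<^sup>2 + 4 / 9 * (L / p)\<^sup>2)"
  proof (rule mult_left_mono)
    define l where "l = L / p"
    \<comment> \<open>the squares arise by eliminating \<open>W\<close>, \<open>A\<close>, \<open>v\<close> and \<open>l\<close> in this order\<close>
    have "16 / 9 * D\<^sup>2 + 4 / 9 * l\<^sup>2 - (2 * D * v - 7 * v\<^sup>2 + D\<^sup>2 + A * v - A\<^sup>2 - W\<^sup>2 + A * W + l * v + l * W)
       = (W - (A + l) / 2)\<^sup>2 + 3 / 4 * (A - 2 / 3 * (v + l / 2))\<^sup>2 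
        + 20 / 3 * (v - 3 / 40 * (2 * D + 4 / 3 * l))\<^sup>2 
        + 2 / 45 * (l - 9 / 4 * D)\<^sup>2 + 29 / 72 * D\<^sup>2"
      by (simp add: power2_eq_square field_simps)
    also have "\<dots> \<ge> 0" by simp
    finally show "2 * D * v - 7 * v\<^sup>2 + D\<^sup>2 + A * v - A\<^sup>2 - W\<^sup>2 + A * W + L / p * v + L / p * W
        \<le> 16 / 9 * D\<^sup>2 + 4 / 9 * (L / p)\<^sup>2"
      by (simp add: l_def)
  qed (use p in simp)
  also have "\<dots> = 2 * ((2 * L\<^sup>2 + 8 * p\<^sup>2 * b\<^sup>2 * (norm (U 0))\<^sup>2) / (9 * p))"
    using p by (simp add: D_def field_simps power2_eq_square)
  finally have "gap 1 \<le> (2 * L\<^sup>2 + 8 * p\<^sup>2 * b\<^sup>2 * (norm (U 0))\<^sup>2) / (9 * p)"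
    by (rule mult_left_le_imp_le) simp
  then show ?thesis unfolding p_def b_def .
qed

text \<open>
  The one-step inequalities for \<open>k = 0\<close> and \<open>k = 1\<close> are combined. The residual \<open>r 2\<close> is a linear
  combination of the vectors \<open>x\<close>, \<open>z\<close>, \<open>a\<close>, \<open>q\<close> and \<open>c - q\<close>, whose squared norms are
  dominated by terms with negative sign in the combined inequality; for \<open>a\<close> such a term comes from
  the slack in the coefficient of \<open>\<parallel>U 0\<parallel>\<^sup>2\<close>. This leaves enough of the squared residual to absorb \<open>L \<parallel>r 2\<parallel>\<close>.
\<close>

lemma gap_2_le:
  assumes mem: "B (yb 2) \<in> X"
    and \<tau>1: "(\<tau> 1)\<^sup>2 = 1 - \<tau> 1"
    and U1: "U 1 = \<tau> 1 *\<^sub>R V 0" and V1: "V 1 = \<tau> 1 *\<^sub>R v"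
    and \<delta>0: "2 * \<rho> 0 * (onorm B)\<^sup>2 * (norm (V 0))\<^sup>2 \<le> \<delta> 0"
    and \<delta>1: "2 * \<rho> 0 * (onorm B)\<^sup>2 * \<tau> 1 * ((norm v)\<^sup>2 + (1 - \<tau> 1) * (norm (V 0 - v))\<^sup>2) \<le> \<delta> 1"
  shows "gap 2 \<le> (2 * L\<^sup>2 + 8 * (\<rho> 0)\<^sup>2 * (onorm B)\<^sup>2 * (norm (U 0))\<^sup>2) / (16 * \<rho> 0)"
proof -
  define p b t s where "p = \<rho> 0" and "b = onorm B" and "t = \<tau> 1" and "s = 1 - t"
  define a c q where "a = B (U 0)" and "c = B (V 0)" and "q = B v"
  define x where "x = t *\<^sub>R (q - c) + (1 / 2) *\<^sub>R (r 2 - s *\<^sub>R r 1)"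
  define z where "z = c - a + (1 / 2) *\<^sub>R r 1"
  have p: "p > 0" using rho_pos by (simp add: p_def)
  have tt: "t * t = s" "0 \<le> t" "t \<le> 1"
    using \<tau>1 tau_bounds[of 1] by (auto simp: t_def s_def power2_eq_square)
  \<comment> \<open>\<open>t\<close> is the positive root of \<open>t\<^sup>2 + t = 1\<close>\<close>
  have t_lo: "618 / 1000 \<le> t"
  proof (rule ccontr)
    assume "\<not> 618 / 1000 \<le> t"
    then have "t * t \<le> 618 / 1000 * (618 / 1000)" using tt(2) by (intro mult_mono) auto
    then show False using tt(1) \<open>\<not> 618 / 1000 \<le> t\<close> by (simp add: s_def)
  qed
  have t_hi: "t \<le> 6181 / 10000"
  proof (rule ccontr)
    assume "\<not> t \<le> 6181 / 10000"
    then have "6181 / 10000 * (6181 / 10000) \<le> t * t" using tt(2) by (intro mult_mono) auto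
    then show False using tt(1) \<open>\<not> t \<le> 6181 / 10000\<close> by (simp add: s_def)
  qed
  have s: "3819 / 10000 \<le> s" "s \<le> 382 / 1000" using t_lo t_hi by (auto simp: s_def)
  have \<rho>1: "\<rho> 1 = p / s" using rho_Suc[of 0] s by (simp add: p_def s_def t_def field_simps)
  have c_U: "(norm a)\<^sup>2 \<le> b\<^sup>2 * (norm (U 0))\<^sup>2" "(norm c)\<^sup>2 \<le> b\<^sup>2 * (norm (V 0))\<^sup>2"
    "(norm q)\<^sup>2 \<le> b\<^sup>2 * (norm v)\<^sup>2" "(norm (c - q))\<^sup>2 \<le> b\<^sup>2 * (norm (V 0 - v))\<^sup>2"
    unfolding a_def b_def c_def q_def B_lin(2)[symmetric] by (rule norm_B_le)+
  define D2 v2 u2 w2 where "D2 = b\<^sup>2 * (norm (U 0))\<^sup>2" and "v2 = b\<^sup>2 * (norm v)\<^sup>2"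
    and "u2 = b\<^sup>2 * (norm (V 0))\<^sup>2" and "w2 = b\<^sup>2 * (norm (V 0 - v))\<^sup>2"
  have e0: "E 1 + 3 / 4 * p * (norm (r 1))\<^sup>2 + p * u2 + p * (norm z)\<^sup>2 + \<delta> 0 \<le> p * D2"
    using descent[of 0]
    by (simp add: tau_0 p_def u2_def D2_def b_def z_def c_def a_def B_lin mult.assoc)
  have d0: "2 * (p * u2) \<le> \<delta> 0"
    using \<delta>0 by (simp add: p_def u2_def b_def mult.assoc)
  have d1: "2 * (p * (t * v2)) + 2 * (p * (t * (s * w2))) \<le> \<delta> 1"
    using \<delta>1 by (simp add: p_def v2_def w2_def b_def t_def s_def algebra_simps)
  have e1: "E 2 + 3 / 4 * (p / s) * (norm (r 2))\<^sup>2 + p * v2 + p / s * (norm x)\<^sup>2 + \<delta> 1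
      \<le> s * E 1 + 3 / 4 * p * s * (norm (r 1))\<^sup>2 + p * u2"
  proof -
    have "B (V 1 - U 1) = t *\<^sub>R (q - c)"
      unfolding U1 V1 by (simp add: B_lin c_def q_def t_def scaleR_diff_right)
    then have "B (V 1 - U 1) + (1 / 2) *\<^sub>R (r (Suc 1) - (1 - \<tau> 1) *\<^sub>R r 1) = x"
      by (simp add: x_def t_def s_def numeral_2_eq_2)
    moreover have "p / s * b\<^sup>2 * (norm (V 1))\<^sup>2 = p * v2" "p / s * b\<^sup>2 * (norm (U 1))\<^sup>2 = p * u2"
      unfolding U1 V1 t_def[symmetric] v2_def u2_def
      using s by (simp_all add: power2_eq_square[of t] tt power_mult_distrib)
    moreover have "3 / 4 * (p / s) * (norm ((1 - \<tau> 1) *\<^sub>R r 1))\<^sup>2 = 3 / 4 * p * s * (norm (r 1))\<^sup>2"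
      unfolding t_def[symmetric] s_def[symmetric]
      using s by (simp add: power_mult_distrib power2_eq_square[of s])
    ultimately show ?thesis
      using descent[of 1] unfolding \<rho>1 b_def[symmetric] t_def[symmetric] s_def[symmetric]
      by (simp add: numeral_2_eq_2 t_def s_def)
  qed
  have e01: "E 2 \<le> p * (s * D2 - s * (norm z)\<^sup>2 - 3 / 4 / s * (norm (r 2))\<^sup>2 - (norm x)\<^sup>2 / s
      - (1 + 2 * t) * v2 - 2 * t * s * w2 - (3 * s - 1) * u2)"
  proof -
    have "s * (E 1 + 3 / 4 * p * (norm (r 1))\<^sup>2 + p * u2 + p * (norm z)\<^sup>2 + 2 * (p * u2)) \<le> s * (p * D2)"
      using e0 d0 s by (intro mult_left_mono) auto
    then show ?thesis using e1 d1 by (simp add: algebra_simps)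
  qed
  have key: "(2 - 3 / 4 / s) * (norm (r 2))\<^sup>2 \<le> (norm x)\<^sup>2 / s + s * (norm z)\<^sup>2 + (1 / 2 - s) * (norm a)\<^sup>2
      + (1 + 2 * t) * (norm q)\<^sup>2 + 2 * t * s * (norm (c - q))\<^sup>2"
  proof -
    have "r 2 = 2 *\<^sub>R x + (2 * s) *\<^sub>R z + (2 * s) *\<^sub>R a - (2 * s) *\<^sub>R q + (2 * (t - s)) *\<^sub>R (c - q)"
      by (simp add: x_def z_def algebra_simps)
    also have "norm \<dots> \<le> norm (2 *\<^sub>R x) + norm ((2 * s) *\<^sub>R z) + norm ((2 * s) *\<^sub>R a)
        + norm ((2 * s) *\<^sub>R q) + norm ((2 * (t - s)) *\<^sub>R (c - q))"
      by (intro norm_triangle_mono norm_triangle_le_diff order.refl add_mono)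
    also have "\<dots> = 2 * norm x + 2 * s * norm z + 2 * s * norm a + 2 * s * norm q + 2 * (t - s) * norm (c - q)"
      using s t_lo by simp
    finally have "(norm (r 2))\<^sup>2 \<le> (2 * norm x + 2 * s * norm z + 2 * s * norm a + 2 * s * norm q
        + 2 * (t - s) * norm (c - q))\<^sup>2"
      by (intro power_mono) auto
    also have "\<dots> \<le> 5 * ((2 * norm x)\<^sup>2 + (2 * s * norm z)\<^sup>2 + (2 * s * norm a)\<^sup>2 + (2 * s * norm q)\<^sup>2
        + (2 * (t - s) * norm (c - q))\<^sup>2)"
      by (rule sum5_sq_le)
    also have "\<dots> = 20 * ((norm x)\<^sup>2 + s\<^sup>2 * (norm z)\<^sup>2 + s\<^sup>2 * (norm a)\<^sup>2 + s\<^sup>2 * (norm q)\<^sup>2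
        + (t - s)\<^sup>2 * (norm (c - q))\<^sup>2)"
      by (simp only: power_mult_distrib) (simp add: distrib_left)
    finally have r2: "(norm (r 2))\<^sup>2 \<le> 20 * ((norm x)\<^sup>2 + s\<^sup>2 * (norm z)\<^sup>2 + s\<^sup>2 * (norm a)\<^sup>2
        + s\<^sup>2 * (norm q)\<^sup>2 + (t - s)\<^sup>2 * (norm (c - q))\<^sup>2)" .
    have "2 - 3 / 4 / s \<le> 37 / 1000" using s by (simp add: field_simps)
    then have "(2 - 3 / 4 / s) * (norm (r 2))\<^sup>2 \<le> 37 / 1000 * (norm (r 2))\<^sup>2"
      by (intro mult_right_mono) auto
    also have "\<dots> \<le> 74 / 100 * ((norm x)\<^sup>2 + s\<^sup>2 * (norm z)\<^sup>2 + s\<^sup>2 * (norm a)\<^sup>2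
        + s\<^sup>2 * (norm q)\<^sup>2 + (t - s)\<^sup>2 * (norm (c - q))\<^sup>2)"
      using r2 by simp
    finally have fin: "(2 - 3 / 4 / s) * (norm (r 2))\<^sup>2 \<le> 74 / 100 * (norm x)\<^sup>2 + 74 / 100 * s\<^sup>2 * (norm z)\<^sup>2
        + 74 / 100 * s\<^sup>2 * (norm a)\<^sup>2 + 74 / 100 * s\<^sup>2 * (norm q)\<^sup>2
        + 74 / 100 * (t - s)\<^sup>2 * (norm (c - q))\<^sup>2" by simp
    have s2: "s\<^sup>2 \<le> 146 / 1000"
      using mult_mono[of s "382/1000" s "382/1000"] s by (simp add: power2_eq_square)
    have ts: "(t - s)\<^sup>2 \<le> 6 / 100"
      using mult_mono[of "t - s" "2363/10000" "t - s" "2363/10000"] s t_lo t_hi by (simp add: power2_eq_square)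
    have "2 * t * s \<ge> 1 / 10"
      using mult_mono[of "1/2" t "1/10" s] s t_lo by simp
    then have "74 / 100 * (t - s)\<^sup>2 * (norm (c - q))\<^sup>2 \<le> 2 * t * s * (norm (c - q))\<^sup>2"
      using ts by (intro mult_right_mono) auto
    moreover have "74 / 100 * s\<^sup>2 * (norm q)\<^sup>2 \<le> (1 + 2 * t) * (norm q)\<^sup>2"
      using s2 t_lo by (intro mult_right_mono) auto
    moreover have "74 / 100 * s\<^sup>2 * (norm a)\<^sup>2 \<le> (1 / 2 - s) * (norm a)\<^sup>2"
      using s2 s by (intro mult_right_mono) auto
    moreover have "74 / 100 * s\<^sup>2 * (norm z)\<^sup>2 \<le> s * (norm z)\<^sup>2"
      using s2 s by (intro mult_right_mono) auto
    moreover have "74 / 100 * (norm x)\<^sup>2 \<le> (norm x)\<^sup>2 / s"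
      using s mult_right_mono[of "74 / 100 * s" 1 "(norm x)\<^sup>2"] by (simp add: pos_le_divide_eq mult_ac)
    ultimately show ?thesis using fin by linarith
  qed
  have "2 * (norm (r 2))\<^sup>2 + s * D2 - s * (norm z)\<^sup>2 - 3 / 4 / s * (norm (r 2))\<^sup>2 - (norm x)\<^sup>2 / s
      - (1 + 2 * t) * v2 - 2 * t * s * w2 - (3 * s - 1) * u2 \<le> D2 / 2"
  proof -
    have "(1 / 2 - s) * (norm a)\<^sup>2 \<le> (1 / 2 - s) * D2"
      using c_U(1) s by (intro mult_left_mono) (auto simp: D2_def)
    moreover have "(1 + 2 * t) * (norm q)\<^sup>2 \<le> (1 + 2 * t) * v2"
      using c_U(3) t_lo by (intro mult_left_mono) (auto simp: v2_def)
    moreover have "2 * t * s * (norm (c - q))\<^sup>2 \<le> 2 * t * s * w2"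
      using c_U(4) t_lo s by (intro mult_left_mono) (auto simp: w2_def)
    moreover have "0 \<le> (3 * s - 1) * u2" using s by (simp add: u2_def)
    ultimately show ?thesis using key by (simp add: left_diff_distrib)
  qed
  from mult_left_mono[OF this, of p] p
  have "2 * p * (norm (r 2))\<^sup>2 + p * (s * D2 - s * (norm z)\<^sup>2 - 3 / 4 / s * (norm (r 2))\<^sup>2 - (norm x)\<^sup>2 / s
      - (1 + 2 * t) * v2 - 2 * t * s * w2 - (3 * s - 1) * u2) \<le> p * (D2 / 2)"
    by (simp add: distrib_left right_diff_distrib)
  then have "E 2 + 2 * p * (norm (r 2))\<^sup>2 \<le> p * (D2 / 2)" using e01 by linarith
  moreover have "gap 2 \<le> E 2 + L * norm (r 2)" using mem by (rule gap_le)
  moreover have "L * norm (r 2) - 2 * p * (norm (r 2))\<^sup>2 \<le> L\<^sup>2 / (4 * (2 * p))"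
    using p by (intro linear_minus_quadratic_le) simp
  ultimately have "gap 2 \<le> p * (D2 / 2) + L\<^sup>2 / (8 * p)" by simp
  also have "\<dots> = (2 * L\<^sup>2 + 8 * p\<^sup>2 * b\<^sup>2 * (norm (U 0))\<^sup>2) / (16 * p)"
    using p by (simp add: D2_def field_simps power2_eq_square)
  finally show ?thesis by (simp add: p_def b_def)
qed

section \<open>Rates for all iterates\<close>

text \<open>
  For \<open>\<tau> k = 1 / (k + 1)\<close> the right-hand side \<open>G k\<close> of \<open>descent\<close>, multiplied by \<open>k + 1\<close>, does not
  increase. The sequence \<open>w k + ys\<close> plays the role of y-tilde in the second scheme.
\<close>

lemma gap_sublinear:
  assumes \<tau>: "\<And>k. \<tau> k = 1 / (real k + 1)" and \<rho>: "\<And>k. \<rho> k = \<rho>0 * (real k + 1)"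
    and U: "\<And>k. U k = \<tau> k *\<^sub>R w k" and V: "\<And>k. V k = \<tau> k *\<^sub>R w (Suc k)"
    and \<delta>: "\<And>k. 0 \<le> \<delta> k" and mem: "B (yb (Suc k)) \<in> X"
  shows "gap (Suc k) \<le> (\<rho>0 * (onorm B)\<^sup>2 * (norm (w 0))\<^sup>2 + L\<^sup>2 / (3 * \<rho>0)) / (real k + 1)"
proof -
  define b D where "b = onorm B" and "D = \<rho>0 * b\<^sup>2 * (norm (w 0))\<^sup>2"
  define H where "H j = E (Suc j) + 3 / 4 * \<rho> j * (norm (r (Suc j)))\<^sup>2" for j
  define G where "G j = (1 - \<tau> j) * E j + 3 / 4 * \<rho> j * (norm ((1 - \<tau> j) *\<^sub>R r j))\<^sup>2
      + \<rho> j * b\<^sup>2 * (norm (U j))\<^sup>2" for j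
  have \<rho>0: "\<rho>0 > 0" using rho_pos[of 0] by (simp add: \<rho>)
  have H_le: "H j + \<rho> j * b\<^sup>2 * (norm (V j))\<^sup>2 \<le> G j" for j
  proof -
    have "0 \<le> \<rho> j * (norm (B (V j - U j) + (1 / 2) *\<^sub>R (r (Suc j) - (1 - \<tau> j) *\<^sub>R r j)))\<^sup>2"
      using rho_pos[of j] by simp
    then show ?thesis using descent[of j] \<delta>[of j] unfolding H_def G_def b_def by linarith
  qed
  have G_le: "(real j + 1) * G j \<le> D" for j
  proof (induction j)
    case 0
    then show ?case by (simp add: G_def tau_0 U D_def \<rho>)
  next
    case (Suc j)
    define n m where "n = real j + 1" and "m = real j + 2"
    have n: "n > 0" "m > 0" by (simp_all add: n_def m_def)
    have eqs: "\<tau> j = 1 / n" "\<tau> (Suc j) = 1 / m" "\<rho> j = \<rho>0 * n" "\<rho> (Suc j) = \<rho>0 * m"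
      by (simp_all add: \<tau> \<rho> n_def m_def add_ac)
    have "1 - 1 / m = n / m" using n by (simp add: field_simps) (simp add: n_def m_def)
    then have "m * G (Suc j) = n * E (Suc j) + 3 / 4 * \<rho>0 * n\<^sup>2 * (norm (r (Suc j)))\<^sup>2
        + \<rho>0 * b\<^sup>2 * (norm (w (Suc j)))\<^sup>2"
      unfolding G_def U eqs using n
      by (simp add: power_mult_distrib power_divide distrib_left power2_eq_square)
    also have "\<dots> = n * (H j + \<rho> j * b\<^sup>2 * (norm (V j))\<^sup>2)"
      unfolding H_def V eqs using n
      by (simp add: power_mult_distrib power_divide distrib_left power2_eq_square)
    also have "\<dots> \<le> n * G j" using H_le n by (intro mult_left_mono) auto
    also have "\<dots> \<le> D" using Suc by (simp add: n_def)
    finally show ?case by (simp add: m_def add_ac)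
  qed
  have "H k \<le> G k"
  proof -
    have "0 \<le> \<rho> k * b\<^sup>2 * (norm (V k))\<^sup>2" using rho_pos[of k] by simp
    then show ?thesis using H_le[of k] by linarith
  qed
  also have "G k \<le> D / (real k + 1)" using G_le[of k] by (simp add: field_simps)
  finally have "gap (Suc k) \<le> D / (real k + 1) + L\<^sup>2 / (3 * \<rho> k)"
    unfolding H_def using mem rho_pos by (intro gap_le_of_potential)
  then show ?thesis using \<rho>0 by (simp add: D_def b_def \<rho> add_divide_distrib mult.assoc)
qed

text \<open>
  Under \<open>\<tau> (k + 1)\<^sup>2 = (1 - \<tau> (k + 1)) \<tau> k\<^sup>2\<close> the right-hand side \<open>G k\<close> of \<open>descent\<close>, divided by
  \<open>\<tau> k\<^sup>2\<close>, does not increase: with \<open>\<delta>\<close> the distance term \<open>W (k + 1)\<close> gets the weight \<open>1 + 2 \<tau> k\<close>, and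
  the next step needs the weight \<open>\<tau> k\<^sup>2 / \<tau> (k + 1)\<^sup>2 = 1 + \<tau> k\<^sup>2 / \<tau> (k + 1)\<close>.
\<close>

lemma gap_quadratic:
  assumes \<tau>: "\<And>k. (\<tau> (Suc k))\<^sup>2 = (1 - \<tau> (Suc k)) * (\<tau> k)\<^sup>2" "\<And>k. 0 < \<tau> k" "\<And>k. \<tau> k \<le> 2 * \<tau> (Suc k)"
    and \<rho>: "\<And>k. \<rho> k = \<rho>0 / (\<tau> k)\<^sup>2"
    and U: "\<And>k. U k = \<tau> k *\<^sub>R w k" and V: "\<And>k. V k = \<tau> k *\<^sub>R w (Suc k)"
    and \<delta>: "\<And>k. 2 * \<rho>0 * (onorm B)\<^sup>2 * \<tau> k * (norm (w (Suc k)))\<^sup>2 \<le> \<delta> k"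
    and mem: "B (yb (Suc k)) \<in> X"
  shows "gap (Suc k) \<le> (\<tau> k)\<^sup>2 * (\<rho>0 * (onorm B)\<^sup>2 * (norm (w 0))\<^sup>2 + L\<^sup>2 / (3 * \<rho>0))"
proof -
  define b D where "b = onorm B" and "D = \<rho>0 * b\<^sup>2 * (norm (w 0))\<^sup>2"
  define W where "W j = \<rho>0 * b\<^sup>2 * (norm (w j))\<^sup>2" for j
  define H where "H j = E (Suc j) + 3 / 4 * \<rho> j * (norm (r (Suc j)))\<^sup>2" for j
  define G where "G j = (1 - \<tau> j) * E j + 3 / 4 * \<rho> j * (norm ((1 - \<tau> j) *\<^sub>R r j))\<^sup>2 + W j" for j
  have \<rho>0: "\<rho>0 > 0" using rho_pos[of 0] by (simp add: \<rho> tau_0)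
  have W: "0 \<le> W j" for j using \<rho>0 by (simp add: W_def)
  have H_le: "H j + (1 + 2 * \<tau> j) * W (Suc j) \<le> G j" for j
  proof -
    have "0 \<le> \<rho> j * (norm (B (V j - U j) + (1 / 2) *\<^sub>R (r (Suc j) - (1 - \<tau> j) *\<^sub>R r j)))\<^sup>2"
      using rho_pos[of j] by simp
    moreover have "\<rho> j * b\<^sup>2 * (norm (U j))\<^sup>2 = W j" "\<rho> j * b\<^sup>2 * (norm (V j))\<^sup>2 = W (Suc j)"
      unfolding U V W_def \<rho> using \<tau>(2)[of j] by (simp_all add: power_mult_distrib)
    moreover have "2 * \<tau> j * W (Suc j) \<le> \<delta> j"
      using \<delta>[of j] by (simp add: W_def b_def mult_ac)
    ultimately show ?thesis
      using descent[of j] unfolding H_def G_def b_def[symmetric] by (simp add: distrib_right)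
  qed
  have G_le: "G j \<le> (\<tau> j)\<^sup>2 * D" for j
  proof (induction j)
    case 0
    then show ?case by (simp add: G_def tau_0 D_def W_def)
  next
    case (Suc j)
    define t t' where "t = \<tau> j" and "t' = \<tau> (Suc j)"
    have t: "0 < t" "0 < t'" "t \<le> 2 * t'" "t'\<^sup>2 = (1 - t') * t\<^sup>2" "t' \<le> 1"
      using \<tau>(1)[of j] \<tau>(2)[of j] \<tau>(2)[of "Suc j"] \<tau>(3)[of j] tau_bounds[of "Suc j"]
      by (simp_all add: t_def t'_def)
    have "1 \<le> (1 - t') * (1 + 2 * t)"
    proof -
      have "t * (t * t') \<le> (2 * t') * (t * t')" using t by (intro mult_right_mono) auto
      then have "t\<^sup>2 \<le> t'\<^sup>2 * (1 + 2 * t)" using t(4) by (simp add: power2_eq_square algebra_simps)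
      also have "\<dots> = (1 - t') * (1 + 2 * t) * t\<^sup>2" unfolding t(4) by simp
      finally show ?thesis using t(1) by (simp add: mult_le_cancel_right1)
    qed
    then have "W (Suc j) \<le> (1 - t') * (1 + 2 * t) * W (Suc j)"
      using W[of "Suc j"] by (simp add: mult_le_cancel_right1)
    moreover have "(1 - t') * (H j + (1 + 2 * t) * W (Suc j)) \<le> (1 - t') * (t\<^sup>2 * D)"
      using H_le[of j] Suc t by (intro mult_left_mono) (auto simp: t_def)
    moreover have "G (Suc j) = (1 - t') * H j + W (Suc j)"
    proof -
      have "3 / 4 * \<rho> (Suc j) * (norm ((1 - t') *\<^sub>R r (Suc j)))\<^sup>2
          = 3 / 4 * (1 - t') * (\<rho> (Suc j) * (1 - t')) * (norm (r (Suc j)))\<^sup>2"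
        by (simp add: power_mult_distrib power2_eq_square)
      also have "\<rho> (Suc j) * (1 - t') = \<rho> j" unfolding t'_def by (rule rho_Suc)
      finally show ?thesis
        unfolding G_def H_def t'_def[symmetric] by (simp add: distrib_left mult_ac)
    qed
    moreover have "(1 - t') * (H j + (1 + 2 * t) * W (Suc j))
        = (1 - t') * H j + (1 - t') * (1 + 2 * t) * W (Suc j)"
      by (simp add: algebra_simps)
    ultimately have "G (Suc j) \<le> (1 - t') * t\<^sup>2 * D" by linarith
    then have "G (Suc j) \<le> t'\<^sup>2 * D" by (simp only: t(4))
    then show ?case unfolding t'_def .
  qed
  have "H k \<le> G k"
  proof -
    have "0 \<le> (1 + 2 * \<tau> k) * W (Suc k)" using W \<tau>(2)[of k] by simp
    then show ?thesis using H_le[of k] by linarith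
  qed
  also note G_le
  finally have "gap (Suc k) \<le> (\<tau> k)\<^sup>2 * D + L\<^sup>2 / (3 * \<rho> k)"
    unfolding H_def using mem rho_pos by (intro gap_le_of_potential)
  then show ?thesis using \<rho>0 by (simp add: D_def b_def \<rho> distrib_left mult.commute[of "L\<^sup>2"])
qed

end

section \<open>The step sizes of the second scheme\<close>

lemma tau2_facts:
  shows "0 < tau2 k" "tau2 k \<le> 1" "(tau2 (Suc k))\<^sup>2 = (1 - tau2 (Suc k)) * (tau2 k)\<^sup>2"
    "tau2 k \<le> 2 * tau2 (Suc k)"
proof -
  have rec: "(tau2 (Suc k))\<^sup>2 = (1 - tau2 (Suc k)) * (tau2 k)\<^sup>2" for k
  proof -
    define h q where "h = tau2 k / 2" and "q = sqrt ((tau2 k)\<^sup>2 + 4)"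
    have q: "q * q = 4 * (h * h) + 4" by (simp add: q_def h_def power2_eq_square)
    have h: "tau2 k = 2 * h" by (simp add: h_def)
    then have t: "tau2 (Suc k) = h * (q - 2 * h)" by (simp add: q_def)
    have "(h * (q - 2 * h))\<^sup>2 = h * h * (q * q - 4 * h * q + 4 * (h * h))"
      by (simp add: power2_eq_square algebra_simps)
    then show ?thesis
      unfolding t h q by (simp add: power2_eq_square algebra_simps)
  qed
  have bounds: "0 < tau2 k \<and> tau2 k \<le> 1" for k
  proof (induction k)
    case (Suc k)
    have "tau2 k < sqrt ((tau2 k)\<^sup>2 + 4)" using Suc by (intro real_less_rsqrt) simp
    then have pos: "0 < tau2 (Suc k)" using Suc by simp
    have "0 \<le> (1 - tau2 (Suc k)) * (tau2 k)\<^sup>2" unfolding rec[symmetric] by simp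
    then have "tau2 (Suc k) \<le> 1" using Suc by (auto simp: zero_le_mult_iff)
    with pos show ?case ..
  qed simp
  show "0 < tau2 k" "tau2 k \<le> 1" using bounds by auto
  show "(tau2 (Suc k))\<^sup>2 = (1 - tau2 (Suc k)) * (tau2 k)\<^sup>2" by (rule rec)
  have "1 + tau2 k \<le> sqrt ((tau2 k)\<^sup>2 + 4)"
    using bounds[of k] by (intro real_le_rsqrt) (simp add: power2_eq_square algebra_simps)
  then have "tau2 k * 1 \<le> tau2 k * (sqrt ((tau2 k)\<^sup>2 + 4) - tau2 k)"
    using bounds[of k] by (intro mult_left_mono) auto
  then show "tau2 k \<le> 2 * tau2 (Suc k)" by simp
qed

text \<open>
  The recursion implies that \<open>1 / \<tau>\<close> grows by at least \<open>1 / 2\<close> in each step. The smaller slope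
  \<open>42 / 100\<close> is chosen so that the inequality holds already at index 2 and that
  \<open>\<tau> (k + 2)\<^sup>2 \<le> 6 / (k + 5)\<^sup>2\<close> follows.
\<close>

lemma tau2_upper_bound: "tau2 (k + 2) * (42 / 100 * (real k + 5)) \<le> 1"
proof (induction k)
  case 0
  \<comment> \<open>the next step size is the positive root of a quadratic that increases on the positive axis\<close>
  have bound: "tau2 (Suc j) \<le> c" if "tau2 j \<le> d" "(1 - c) * d\<^sup>2 \<le> c\<^sup>2" "c \<ge> 0" "d \<ge> 0" for j c d
  proof (rule ccontr)
    assume "\<not> tau2 (Suc j) \<le> c"
    then have gt: "c < tau2 (Suc j)" by simp
    have "c\<^sup>2 < (tau2 (Suc j))\<^sup>2" using gt that by (intro power_strict_mono) auto
    also have "\<dots> = (1 - tau2 (Suc j)) * (tau2 j)\<^sup>2" by (rule tau2_facts)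
    also have "\<dots> \<le> (1 - c) * d\<^sup>2"
      using gt that tau2_facts(1)[of j] tau2_facts(2)[of "Suc j"] by (intro mult_mono power_mono) auto
    finally show False using that by simp
  qed
  have "tau2 (Suc 0) \<le> 6181 / 10000"
    by (rule bound[of 0 1]) (simp_all add: power2_eq_square)
  then have "tau2 (Suc (Suc 0)) \<le> 46 / 100"
    by (rule bound) (simp_all add: power2_eq_square)
  then show ?case by (simp add: numeral_2_eq_2 del: tau2.simps)
next
  case (Suc k)
  define t t' where "t = tau2 (k + 2)" and "t' = tau2 (Suc (k + 2))"
  have t: "0 < t" "0 < t'" "t'\<^sup>2 = (1 - t') * t\<^sup>2" "t' \<le> 1"
    unfolding t_def t'_def by (rule tau2_facts)+
  have prod: "(t - t') * (t + t') = t * t * t'"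
    using t(3) by (simp add: power2_eq_square algebra_simps)
  have "0 \<le> (t - t') * (t + t')" unfolding prod using t by simp
  then have le: "t' \<le> t" using t by (simp add: zero_le_mult_iff)
  have "t * t * t' \<le> (t - t') * (2 * t)"
    unfolding prod[symmetric] using t le by (intro mult_left_mono) auto
  then have "t * (t * t') \<le> t * (2 * (t - t'))" by (simp add: mult_ac)
  then have "t * t' \<le> 2 * (t - t')" using t(1) by (rule mult_left_le_imp_le)
  then have step: "t' * (1 + t / 2) \<le> t" by (simp add: algebra_simps)
  define c where "c = 42 / 100 * (real k + 5)"
  have c: "t * c \<le> 1" "0 \<le> c" using Suc by (simp_all add: t_def c_def)
  have "t' * (1 + t / 2) * (c + 42 / 100) \<le> t * (c + 42 / 100)"
    using step c by (intro mult_right_mono) auto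
  also have "\<dots> \<le> 1 + t / 2" using c t(1) by (simp add: distrib_left)
  finally have "(1 + t / 2) * (t' * (c + 42 / 100)) \<le> (1 + t / 2) * 1" by (simp add: mult_ac)
  then have "t' * (c + 42 / 100) \<le> 1" by (rule mult_left_le_imp_le) (use t(1) in simp)
  moreover have "c + 42 / 100 = 42 / 100 * (real (Suc k) + 5)" by (simp add: c_def)
  ultimately show ?case by (simp only: t'_def add_Suc)
qed

section \<open>Both schemes as instances of the common iteration\<close>

lemma prox_step_inequality:
  fixes g :: "'y::euclidean_space \<Rightarrow> ereal" and B :: "'y \<Rightarrow> 'x::euclidean_space"
    and u :: 'x and v :: 'y
  assumes g: "proper g" "closed_fun g" "convex_fun g" and B: "linear B" and \<beta>: "\<beta> > 0"
  defines "p \<equiv> prox (1 / \<beta>) g (v - (1 / \<beta>) *\<^sub>R adjoint B u)"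
  shows "subgradient g p (\<beta> *\<^sub>R (v - p) - adjoint B u)"
    and "(\<beta> *\<^sub>R (v - p) - adjoint B u) \<bullet> (y - p) = u \<bullet> B (p - y) - \<beta> * ((v - p) \<bullet> (p - y))"
proof -
  have "1 / (1 / \<beta>) = \<beta>" by simp
  moreover have "\<beta> *\<^sub>R (v - (1 / \<beta>) *\<^sub>R adjoint B u - p) = \<beta> *\<^sub>R (v - p) - adjoint B u"
    using \<beta> by (simp add: algebra_simps)
  ultimately show "subgradient g p (\<beta> *\<^sub>R (v - p) - adjoint B u)"
    using prox_subgradient[OF g, of "1 / \<beta>" "v - (1 / \<beta>) *\<^sub>R adjoint B u"] \<beta>
    unfolding p_def[symmetric] by simp
  have "adjoint B u \<bullet> (p - y) = u \<bullet> B (p - y)"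
    using adjoint_works[OF B, of "p - y" u] by (simp add: inner_commute)
  moreover have "(\<beta> *\<^sub>R (v - p) - adjoint B u) \<bullet> (y - p) = adjoint B u \<bullet> (p - y) - \<beta> * ((v - p) \<bullet> (p - y))"
    by (simp add: inner_diff algebra_simps)
  ultimately show "(\<beta> *\<^sub>R (v - p) - adjoint B u) \<bullet> (y - p) = u \<bullet> B (p - y) - \<beta> * ((v - p) \<bullet> (p - y))"
    by simp
qed

text \<open>
  The absolute value matters only if the domain is a single point: then \<open>L\<close> may be negative.
\<close>

lemma lipschitz_on_dom_real:
  assumes "proper f" "lipschitz_on_dom L f" "x \<in> effdom f" "x' \<in> effdom f"
  shows "real_of_ereal (f x) - real_of_ereal (f x') \<le> \<bar>L\<bar> * norm (x - x')"
proof -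
  have "\<bar>f x - f x'\<bar> \<le> ereal (L * norm (x - x'))" using assms by (simp add: lipschitz_on_dom_def)
  moreover have "f x - f x' = ereal (real_of_ereal (f x) - real_of_ereal (f x'))"
    using assms effdom_ereal_real[of f] by (metis ereal_minus(1))
  ultimately have "real_of_ereal (f x) - real_of_ereal (f x') \<le> L * norm (x - x')" by simp
  also have "\<dots> \<le> \<bar>L\<bar> * norm (x - x')" by (intro mult_right_mono) auto
  finally show ?thesis .
qed

lemma onorm_pos:
  fixes B :: "'y::euclidean_space \<Rightarrow> 'x::real_normed_vector"
  assumes "linear B" "B \<noteq> (\<lambda>y. 0)"
  shows "0 < onorm B"
  using assms by (auto simp: linear_conv_bounded_linear onorm_pos_lt)

lemma optimal_point_effdom:
  assumes "proper f" "proper g" "optimal_value_finite_attained f g B"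
    and min: "\<And>y. objective f g B ys \<le> objective f g B y"
  shows "B ys \<in> effdom f" "ys \<in> effdom g"
proof -
  have v: "Inf (constrained_values f g B) \<in> constrained_values f g B"
    "\<bar>Inf (constrained_values f g B)\<bar> \<noteq> \<infinity>"
    using assms(3) by (simp_all add: optimal_value_finite_attained_def)
  from v(1) obtain x y where xy: "Inf (constrained_values f g B) = f x + g y" "x - B y = 0"
    by (subst (asm) (2) constrained_values_def) blast
  have "x = B y" using xy(2) by simp
  then have "objective f g B ys \<le> f x + g y" using min[of y] by (simp only: objective_def)
  also have "\<dots> < \<infinity>" using v(2) unfolding xy(1) by (cases "f x + g y") simp_all
  finally have "f (B ys) + g ys < \<infinity>" by (simp add: objective_def)
  moreover have "f (B ys) \<noteq> -\<infinity>" "g ys \<noteq> -\<infinity>" using assms by (auto simp: proper_def)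
  ultimately have "f (B ys) < \<infinity> \<and> g ys < \<infinity>"
    by (cases "f (B ys)"; cases "g ys") auto
  then show "B ys \<in> effdom f" "ys \<in> effdom g"
    by (simp_all add: effdom_def)
qed

lemma objective_diff_eq:
  assumes "proper f" "proper g" "B y \<in> effdom f" "y \<in> effdom g" "B y' \<in> effdom f" "y' \<in> effdom g"
  shows "objective f g B y - objective f g B y' = ereal (real_of_ereal (f (B y)) + real_of_ereal (g y)
      - (real_of_ereal (f (B y')) + real_of_ereal (g y')))"
  unfolding objective_def
  using effdom_ereal_real[OF assms(1,3)] effdom_ereal_real[OF assms(2,4)]
    effdom_ereal_real[OF assms(1,5)] effdom_ereal_real[OF assms(2,6)]
  by (metis ereal_minus(1) plus_ereal.simps(1))

text \<open>
  The optimality condition of the proximal step is applied at the convex combination of the old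
  y-bar and \<open>ys\<close>.
\<close>

lemma scheme1_iteration:
  fixes f :: "'x::euclidean_space \<Rightarrow> ereal" and g :: "'y::euclidean_space \<Rightarrow> ereal"
  assumes f: "proper f" "closed_fun f" "convex_fun f"
    and g: "proper g" "closed_fun g" "convex_fun g"
    and B: "linear B" "B \<noteq> (\<lambda>y. 0)" and Lip: "lipschitz_on_dom L f"
    and ys: "B ys \<in> effdom f" "ys \<in> effdom g"
    and \<rho>0: "\<rho>0 > 0" and scheme: "scheme1 f g B \<rho>0 xc xb yb yh lh"
  shows "primal_dual_iteration (\<lambda>x. real_of_ereal (f x)) (\<lambda>y. real_of_ereal (g y)) (effdom f) B \<bar>L\<bar> ys
      tau1 (rho1 \<rho>0) xc xb lh yb yh (\<lambda>_. 0)"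
    and "yb k \<in> effdom g"
proof -
  define b where "b = onorm B"
  have b: "b > 0" using onorm_pos[OF B] by (simp add: b_def)
  have \<rho>: "rho1 \<rho>0 k > 0" and \<beta>: "beta1 \<rho>0 B k > 0" for k
    using \<rho>0 b by (auto simp: rho1_def beta1_def b_def)
  have init: "yb 0 \<in> effdom g" "xb 0 \<in> effdom f" "yh 0 = yb 0" "lh 0 = 0"
    using scheme by (simp_all add: scheme1_def)
  have xc: "xc (Suc k) = prox (rho1 \<rho>0 k) (fenchel_conj f) (lh k + rho1 \<rho>0 k *\<^sub>R B (yh k))"
    and yb: "yb (Suc k) = prox (1 / beta1 \<rho>0 B k) g (yh k - (1 / beta1 \<rho>0 B k) *\<^sub>R adjoint B (xc (Suc k)))"
    and xb: "xb (Suc k) = B (yh k) + (1 / rho1 \<rho>0 k) *\<^sub>R (lh k - xc (Suc k))"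
    and lh: "lh (Suc k) = lh k - (eta1 \<rho>0 k / tau1 k) *\<^sub>R
          (xb (Suc k) - (1 - tau1 k) *\<^sub>R xb k - B (yb (Suc k) - (1 - tau1 k) *\<^sub>R yb k))" for k
    using scheme unfolding scheme1_def Let_def by blast+
  have sf: "subgradient f (xb (Suc k)) (xc (Suc k))" for k
  proof -
    have "xb (Suc k) = (1 / rho1 \<rho>0 k) *\<^sub>R (lh k + rho1 \<rho>0 k *\<^sub>R B (yh k) - xc (Suc k))"
      using \<rho>[of k] by (simp add: xb algebra_simps)
    then show ?thesis using moreau_prox_subgradient[OF f \<rho>] xc by simp
  qed
  have sg: "subgradient g (yb (Suc k)) (beta1 \<rho>0 B k *\<^sub>R (yh k - yb (Suc k)) - adjoint B (xc (Suc k)))"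
    and sg_inner: "(beta1 \<rho>0 B k *\<^sub>R (yh k - yb (Suc k)) - adjoint B (xc (Suc k))) \<bullet> (y - yb (Suc k))
      = xc (Suc k) \<bullet> B (yb (Suc k) - y) - beta1 \<rho>0 B k * ((yh k - yb (Suc k)) \<bullet> (yb (Suc k) - y))" for k y
    unfolding yb by (rule prox_step_inequality[OF g B(1) \<beta>])+
  have yb_dom: "yb k \<in> effdom g" for k
    using init sg by (cases k) (auto simp: subgradient_def)
  have xb_dom: "xb k \<in> effdom f" for k
    using init sf by (cases k) (auto simp: subgradient_def)
  show "yb k \<in> effdom g" by (rule yb_dom)
  show "primal_dual_iteration (\<lambda>x. real_of_ereal (f x)) (\<lambda>y. real_of_ereal (g y)) (effdom f) B \<bar>L\<bar> ys
      tau1 (rho1 \<rho>0) xc xb lh yb yh (\<lambda>_. 0)"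
  proof
    fix k
    show "rho1 \<rho>0 (Suc k) * (1 - tau1 (Suc k)) = rho1 \<rho>0 k"
      by (simp add: rho1_def tau1_def field_simps)
    have "eta1 \<rho>0 k / tau1 k = rho1 \<rho>0 k / 2" by (simp add: eta1_def tau1_def rho1_def)
    moreover have "xb (Suc k) - (1 - tau1 k) *\<^sub>R xb k - B (yb (Suc k) - (1 - tau1 k) *\<^sub>R yb k)
        = xb (Suc k) - B (yb (Suc k)) - (1 - tau1 k) *\<^sub>R (xb k - B (yb k))"
      using B(1) by (simp add: linear_diff linear_scale scaleR_diff_right)
    ultimately show "lh (Suc k) = lh k - (rho1 \<rho>0 k / 2) *\<^sub>R
        (xb (Suc k) - B (yb (Suc k)) - (1 - tau1 k) *\<^sub>R (xb k - B (yb k)))"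
      unfolding lh by (simp only:)
    let ?y = "(1 - tau1 k) *\<^sub>R yb k + tau1 k *\<^sub>R ys"
    have t: "0 \<le> tau1 k" "tau1 k \<le> 1" by (auto simp: tau1_def)
    have "real_of_ereal (g (yb (Suc k))) + (xc (Suc k) \<bullet> B (yb (Suc k) - ?y)
        - beta1 \<rho>0 B k * ((yh k - yb (Suc k)) \<bullet> (yb (Suc k) - ?y))) \<le> real_of_ereal (g ?y)"
      using subgradient_realD[OF g(1) sg convex_fun_effdom(1)[OF g(1,3) yb_dom ys(2) t]]
      unfolding sg_inner .
    also have "\<dots> \<le> (1 - tau1 k) * real_of_ereal (g (yb k)) + tau1 k * real_of_ereal (g ys)"
      by (rule convex_fun_effdom(2)[OF g(1,3) yb_dom ys(2) t])
    also have "yb (Suc k) - ?y = yb (Suc k) - (1 - tau1 k) *\<^sub>R yb k - tau1 k *\<^sub>R ys" by simp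
    also have "beta1 \<rho>0 B k = 2 * rho1 \<rho>0 k * (onorm B)\<^sup>2" by (simp add: beta1_def rho1_def)
    finally show "real_of_ereal (g (yb (Suc k))) + 0
        \<le> (1 - tau1 k) * real_of_ereal (g (yb k)) + tau1 k * real_of_ereal (g ys)
          + 2 * rho1 \<rho>0 k * (onorm B)\<^sup>2 * ((yh k - yb (Suc k)) \<bullet> 
              (yb (Suc k) - (1 - tau1 k) *\<^sub>R yb k - tau1 k *\<^sub>R ys))
          - xc (Suc k) \<bullet> B (yb (Suc k) - (1 - tau1 k) *\<^sub>R yb k - tau1 k *\<^sub>R ys)"
      by simp
  qed (use \<rho> init xb_dom ys(1) sf xb in \<open>auto simp: tau1_def linear_add[OF B(1)] linear_scale[OF B(1)]
        intro: subgradient_realD[OF f(1)] lipschitz_on_dom_real[OF f(1) Lip] convex_fun_effdom[OF f(1,3)]\<close>)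
qed

text \<open>
  The proximal step produces y-tilde, where the improved subgradient inequality is applied at \<open>ys\<close>;
  strong convexity is used a second time for the convex combination that defines y-bar.
\<close>

lemma scheme2_iteration:
  fixes f :: "'x::euclidean_space \<Rightarrow> ereal" and g :: "'y::euclidean_space \<Rightarrow> ereal"
  assumes f: "proper f" "closed_fun f" "convex_fun f"
    and g: "proper g" "closed_fun g" "convex_fun g" "strongly_convex_fun \<mu> g"
    and B: "linear B" "B \<noteq> (\<lambda>y. 0)" and Lip: "lipschitz_on_dom L f"
    and ys: "B ys \<in> effdom f" "ys \<in> effdom g"
    and \<rho>0: "\<rho>0 > 0" and scheme: "scheme2 f g B \<rho>0 xc xb yb yh yt lh"
  shows "primal_dual_iteration (\<lambda>x. real_of_ereal (f x)) (\<lambda>y. real_of_ereal (g y)) (effdom f) B \<bar>L\<bar> ys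
      tau2 (rho2 \<rho>0) xc xb lh yb yh (\<lambda>k. \<mu> / 2 * (tau2 k * ((norm (yt (Suc k) - ys))\<^sup>2
        + (1 - tau2 k) * (norm (yb k - yt (Suc k)))\<^sup>2)))"
    and "yb k \<in> effdom g"
proof -
  define b where "b = onorm B"
  have b: "b > 0" using onorm_pos[OF B] by (simp add: b_def)
  note tau = tau2_facts(1,2)
  have \<rho>: "rho2 \<rho>0 k > 0" for k
    using \<rho>0 tau[of k] by (auto simp: rho2_def)
  have \<beta>: "tau2 k * beta2 \<rho>0 B k > 0" for k
    using \<rho>[of k] b tau[of k] by (auto simp: beta2_def b_def)
  have init: "yb 0 \<in> effdom g" "xb 0 \<in> effdom f" "yt 0 = yb 0" "lh 0 = 0"
    using scheme by (simp_all add: scheme2_def)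
  have yh: "yh k = (1 - tau2 k) *\<^sub>R yb k + tau2 k *\<^sub>R yt k"
    and xc: "xc (Suc k) = prox (rho2 \<rho>0 k) (fenchel_conj f) (lh k + rho2 \<rho>0 k *\<^sub>R B (yh k))"
    and yt: "yt (Suc k) = prox (1 / (tau2 k * beta2 \<rho>0 B k)) g 
        (yt k - (1 / (tau2 k * beta2 \<rho>0 B k)) *\<^sub>R adjoint B (xc (Suc k)))"
    and xb: "xb (Suc k) = B (yh k) + (1 / rho2 \<rho>0 k) *\<^sub>R (lh k - xc (Suc k))"
    and yb: "yb (Suc k) = (1 - tau2 k) *\<^sub>R yb k + tau2 k *\<^sub>R yt (Suc k)"
    and lh: "lh (Suc k) = lh k - (eta2 \<rho>0 k / tau2 k) *\<^sub>R (xb (Suc k) - (1 - tau2 k) *\<^sub>R xb k)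
          + eta2 \<rho>0 k *\<^sub>R B (yt (Suc k))" for k
    using scheme unfolding scheme2_def Let_def by blast+
  have sf: "subgradient f (xb (Suc k)) (xc (Suc k))" for k
  proof -
    have "xb (Suc k) = (1 / rho2 \<rho>0 k) *\<^sub>R (lh k + rho2 \<rho>0 k *\<^sub>R B (yh k) - xc (Suc k))"
      using \<rho>[of k] by (simp add: xb algebra_simps)
    then show ?thesis using moreau_prox_subgradient[OF f \<rho>] xc by simp
  qed
  have sg: "subgradient g (yt (Suc k)) 
        ((tau2 k * beta2 \<rho>0 B k) *\<^sub>R (yt k - yt (Suc k)) - adjoint B (xc (Suc k)))"
    and sg_inner: "((tau2 k * beta2 \<rho>0 B k) *\<^sub>R (yt k - yt (Suc k)) - adjoint B (xc (Suc k))) \<bullet> (y - yt (Suc k))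
      = xc (Suc k) \<bullet> B (yt (Suc k) - y) - tau2 k * beta2 \<rho>0 B k * ((yt k - yt (Suc k)) \<bullet> (yt (Suc k) - y))"
    for k y
    unfolding yt[of k] by (rule prox_step_inequality[OF g(1-3) B(1) \<beta>])+
  have yt_dom: "yt k \<in> effdom g" for k
    using init sg by (cases k) (auto simp: subgradient_def)
  have yb_dom: "yb k \<in> effdom g" for k
  proof (induction k)
    case (Suc k)
    then show ?case
      unfolding yb using convex_fun_effdom(1)[OF g(1,3) Suc yt_dom] tau[of k] by simp
  qed (rule init)
  have xb_dom: "xb k \<in> effdom f" for k
    using init sf by (cases k) (auto simp: subgradient_def)
  show "yb k \<in> effdom g" by (rule yb_dom)
  show "primal_dual_iteration (\<lambda>x. real_of_ereal (f x)) (\<lambda>y. real_of_ereal (g y)) (effdom f) B \<bar>L\<bar> ys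
      tau2 (rho2 \<rho>0) xc xb lh yb yh (\<lambda>k. \<mu> / 2 * (tau2 k * ((norm (yt (Suc k) - ys))\<^sup>2
        + (1 - tau2 k) * (norm (yb k - yt (Suc k)))\<^sup>2)))"
  proof
    fix k
    define t where "t = tau2 k"
    have t: "0 < t" "0 \<le> t" "t \<le> 1" using tau[of k] by (simp_all add: t_def)
    have "(1 - tau2 (Suc k)) / (tau2 (Suc k))\<^sup>2 = 1 / (tau2 k)\<^sup>2"
      using tau[of k] tau[of "Suc k"] tau2_facts(3)[of k] by (simp add: field_simps del: tau2.simps)
    then show "rho2 \<rho>0 (Suc k) * (1 - tau2 (Suc k)) = rho2 \<rho>0 k"
      by (simp add: rho2_def del: tau2.simps) (metis mult.right_neutral times_divide_eq_right)
    have eta: "eta2 \<rho>0 k / t = rho2 \<rho>0 k / 2" "eta2 \<rho>0 k = rho2 \<rho>0 k / 2 * t"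
      using t by (simp_all add: eta2_def rho2_def t_def[symmetric] power2_eq_square)
    have yt_yb: "t *\<^sub>R yt (Suc k) = yb (Suc k) - (1 - t) *\<^sub>R yb k" by (simp add: yb t_def)
    have "eta2 \<rho>0 k *\<^sub>R B (yt (Suc k)) = (rho2 \<rho>0 k / 2) *\<^sub>R B (t *\<^sub>R yt (Suc k))"
      unfolding eta(2) using B(1) by (simp add: linear_scale)
    then show "lh (Suc k) = lh k - (rho2 \<rho>0 k / 2) *\<^sub>R
        (xb (Suc k) - B (yb (Suc k)) - (1 - tau2 k) *\<^sub>R (xb k - B (yb k)))"
      unfolding lh t_def[symmetric] eta(1) yt_yb using B(1)
      by (simp add: linear_diff linear_scale scaleR_diff_right)
    define v where "v = yt (Suc k) - ys"
    define I where "I = (yt k - yt (Suc k)) \<bullet> v"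
    have V: "yb (Suc k) - (1 - t) *\<^sub>R yb k - t *\<^sub>R ys = t *\<^sub>R v"
      by (simp add: yb t_def[symmetric] v_def algebra_simps)
    have d: "yh k - yb (Suc k) = t *\<^sub>R (yt k - yt (Suc k))"
      by (simp add: yh yb t_def[symmetric] algebra_simps)
    have "real_of_ereal (g (yb (Suc k))) + \<mu> / 2 * (t * (1 - t) * (norm (yb k - yt (Suc k)))\<^sup>2)
        \<le> (1 - t) * real_of_ereal (g (yb k)) + t * real_of_ereal (g (yt (Suc k)))"
      unfolding yb t_def[symmetric]
      by (rule strongly_convex_fun_real[OF g(1,4) yb_dom yt_dom t(2,3)])
    moreover have "real_of_ereal (g (yt (Suc k))) + (xc (Suc k) \<bullet> B v - t * beta2 \<rho>0 B k * I)
         + \<mu> / 2 * (norm v)\<^sup>2 \<le> real_of_ereal (g ys)"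
      using strongly_convex_subgradient[OF g(1,3,4) sg ys(2)]
      unfolding sg_inner v_def I_def t_def by (simp add: norm_minus_commute)
    from mult_left_mono[OF this t(2)]
    have "t * real_of_ereal (g (yt (Suc k))) + t * (xc (Suc k) \<bullet> B v) - t * (t * beta2 \<rho>0 B k * I)
         + t * (\<mu> / 2 * (norm v)\<^sup>2) \<le> t * real_of_ereal (g ys)"
      by (simp only: distrib_left right_diff_distrib)
    moreover have "2 * rho2 \<rho>0 k * (onorm B)\<^sup>2 * ((yh k - yb (Suc k)) \<bullet> (t *\<^sub>R v)) = t * (t * beta2 \<rho>0 B k * I)"
      unfolding d by (simp add: beta2_def I_def)
    moreover have "xc (Suc k) \<bullet> B (t *\<^sub>R v) = t * (xc (Suc k) \<bullet> B v)"
      using B(1) by (simp add: linear_scale)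
    moreover have "\<mu> / 2 * (t * ((norm v)\<^sup>2 + (1 - t) * (norm (yb k - yt (Suc k)))\<^sup>2))
      = t * (\<mu> / 2 * (norm v)\<^sup>2) + \<mu> / 2 * (t * (1 - t) * (norm (yb k - yt (Suc k)))\<^sup>2)"
      by (simp only: distrib_left mult_ac)
    ultimately show "real_of_ereal (g (yb (Suc k))) + \<mu> / 2 * (tau2 k * ((norm (yt (Suc k) - ys))\<^sup>2
        + (1 - tau2 k) * (norm (yb k - yt (Suc k)))\<^sup>2))
        \<le> (1 - tau2 k) * real_of_ereal (g (yb k)) + tau2 k * real_of_ereal (g ys)
          + 2 * rho2 \<rho>0 k * (onorm B)\<^sup>2 * ((yh k - yb (Suc k)) \<bullet> 
              (yb (Suc k) - (1 - tau2 k) *\<^sub>R yb k - tau2 k *\<^sub>R ys))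
          - xc (Suc k) \<bullet> B (yb (Suc k) - (1 - tau2 k) *\<^sub>R yb k - tau2 k *\<^sub>R ys)"
      unfolding t_def[symmetric] v_def[symmetric] V by linarith
  qed (use \<rho> init xb_dom ys(1) sf xb tau in \<open>auto simp: linear_add[OF B(1)] linear_scale[OF B(1)] less_imp_le
        intro: subgradient_realD[OF f(1)] lipschitz_on_dom_real[OF f(1) Lip] convex_fun_effdom[OF f(1,3)]\<close>)
qed

section \<open>The convergence bounds\<close>

lemma scheme1_bound:
  fixes f :: "'x::euclidean_space \<Rightarrow> ereal" and g :: "'y::euclidean_space \<Rightarrow> ereal"
  assumes f: "proper f" "closed_fun f" "convex_fun f"
    and g: "proper g" "closed_fun g" "convex_fun g"
    and B: "linear B" "B \<noteq> (\<lambda>y. 0)" and Lip: "lipschitz_on_dom L f"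
    and ys: "B ys \<in> effdom f" "ys \<in> effdom g"
    and \<rho>0: "\<rho>0 > 0" and scheme: "scheme1 f g B \<rho>0 xc xb yb yh lh"
    and k: "k \<ge> 1" and mem: "B (yb k) \<in> effdom f"
  shows "objective f g B (yb k) - objective f g B ys
     \<le> ereal ((2 * \<rho>0\<^sup>2 * (onorm B)\<^sup>2 * (norm (yb 0 - ys))\<^sup>2 + 2 * L\<^sup>2) / (\<rho>0 * real k))"
proof -
  interpret primal_dual_iteration "\<lambda>x. real_of_ereal (f x)" "\<lambda>y. real_of_ereal (g y)" "effdom f"
    B "\<bar>L\<bar>" ys tau1 "rho1 \<rho>0" xc xb lh yb yh "\<lambda>_. 0"
    by (rule scheme1_iteration(1)[OF f g B Lip ys \<rho>0 scheme])
  have yb: "yb k \<in> effdom g" by (rule scheme1_iteration(2)[OF f g B Lip ys \<rho>0 scheme])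
  have yh: "yh (Suc j) = yb (Suc j) + ((1 - tau1 j) * tau1 (Suc j) / tau1 j) *\<^sub>R (yb (Suc j) - yb j)" 
    and yh0: "yh 0 = yb 0" for j
    using scheme unfolding scheme1_def Let_def by blast+
  \<comment> \<open>y-hat is \<open>1 - \<tau>\<close> times y-bar plus \<open>\<tau>\<close> times \<open>w j + ys\<close>; by the extrapolation step the new y-bar
    is the same combination with \<open>w (Suc j) + ys\<close>\<close>
  define w where "w j = (1 / tau1 j) *\<^sub>R U j" for j
  have t: "tau1 j \<noteq> 0" for j by (simp add: tau1_def)
  have U: "U j = tau1 j *\<^sub>R w j" for j using t by (simp add: w_def)
  have V: "V j = tau1 j *\<^sub>R w (Suc j)" for j
  proof -
    define a c where "a = tau1 j" and "c = tau1 (Suc j)"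
    have ac: "a \<noteq> 0" "c \<noteq> 0" using t by (auto simp: a_def c_def)
    have "a *\<^sub>R U (Suc j) = (a * c) *\<^sub>R yb (Suc j) + (a * ((1 - a) * c / a)) *\<^sub>R (yb (Suc j) - yb j) - (a * c) *\<^sub>R ys"
      unfolding U_def yh a_def[symmetric] c_def[symmetric] by (simp add: algebra_simps)
    also have "a * ((1 - a) * c / a) = c - a * c" using ac by (simp add: left_diff_distrib)
    also have "(a * c) *\<^sub>R yb (Suc j) + (c - a * c) *\<^sub>R (yb (Suc j) - yb j) - (a * c) *\<^sub>R ys = c *\<^sub>R V j"
      by (simp add: V_def a_def[symmetric] algebra_simps)
    finally have "(1 / c) *\<^sub>R a *\<^sub>R U (Suc j) = V j" using ac by simp
    then show ?thesis by (simp add: w_def a_def c_def)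
  qed
  have w0: "w 0 = yb 0 - ys" by (simp add: w_def U_def tau1_def yh0)
  obtain j where j: "k = Suc j" using k by (cases k) auto
  have "gap k \<le> (\<rho>0 * (onorm B)\<^sup>2 * (norm (w 0))\<^sup>2 + \<bar>L\<bar>\<^sup>2 / (3 * \<rho>0)) / (real j + 1)"
    unfolding j
  proof (rule gap_sublinear[OF _ _ U V])
    show "B (yb (Suc j)) \<in> effdom f" using mem j by simp
  qed (simp_all add: tau1_def rho1_def)
  also have "\<dots> \<le> (2 * \<rho>0 * (onorm B)\<^sup>2 * (norm (w 0))\<^sup>2 + 2 * L\<^sup>2 / \<rho>0) / (real j + 1)"
  proof (intro divide_right_mono add_mono)
    show "\<bar>L\<bar>\<^sup>2 / (3 * \<rho>0) \<le> 2 * L\<^sup>2 / \<rho>0"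
      using \<rho>0 by (simp add: field_simps)
  qed (use \<rho>0 in \<open>auto simp: mult.assoc\<close>)
  also have "\<dots> = (2 * \<rho>0\<^sup>2 * (onorm B)\<^sup>2 * (norm (yb 0 - ys))\<^sup>2 + 2 * L\<^sup>2) / (\<rho>0 * real k)"
    using \<rho>0 by (simp add: w0 j field_simps power2_eq_square)
  finally show ?thesis
    unfolding objective_diff_eq[of f g B, OF f(1) g(1) mem yb ys] by (simp add: gap_def)
qed

lemma scheme2_bound:
  fixes f :: "'x::euclidean_space \<Rightarrow> ereal" and g :: "'y::euclidean_space \<Rightarrow> ereal"
  assumes f: "proper f" "closed_fun f" "convex_fun f"
    and g: "proper g" "closed_fun g" "convex_fun g" "strongly_convex_fun \<mu> g"
    and B: "linear B" "B \<noteq> (\<lambda>y. 0)" and Lip: "lipschitz_on_dom L f"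
    and ys: "B ys \<in> effdom f" "ys \<in> effdom g"
    and \<rho>0: "\<rho>0 > 0" "\<rho>0 \<le> \<mu> / (4 * (onorm B)\<^sup>2)"
    and scheme: "scheme2 f g B \<rho>0 xc xb yb yh yt lh"
    and k: "k \<ge> 1" and mem: "B (yb k) \<in> effdom f"
  shows "objective f g B (yb k) - objective f g B ys
     \<le> ereal ((2 * L\<^sup>2 + 8 * \<rho>0\<^sup>2 * (onorm B)\<^sup>2 * (norm (yb 0 - ys))\<^sup>2) / (\<rho>0 * (real k + 2)\<^sup>2))"
proof -
  interpret primal_dual_iteration "\<lambda>x. real_of_ereal (f x)" "\<lambda>y. real_of_ereal (g y)" "effdom f"
    B "\<bar>L\<bar>" ys tau2 "rho2 \<rho>0" xc xb lh yb yh "\<lambda>k. \<mu> / 2 * (tau2 k * ((norm (yt (Suc k) - ys))\<^sup>2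
        + (1 - tau2 k) * (norm (yb k - yt (Suc k)))\<^sup>2))"
    by (rule scheme2_iteration(1)[OF f g B Lip ys \<rho>0(1) scheme])
  have yb_dom: "yb k \<in> effdom g" by (rule scheme2_iteration(2)[OF f g B Lip ys \<rho>0(1) scheme])
  have yh: "yh j = (1 - tau2 j) *\<^sub>R yb j + tau2 j *\<^sub>R yt j"
    and yb: "yb (Suc j) = (1 - tau2 j) *\<^sub>R yb j + tau2 j *\<^sub>R yt (Suc j)"
    and yt0: "yt 0 = yb 0" for j
    using scheme unfolding scheme2_def Let_def by blast+
  define w where "w j = yt j - ys" for j
  have U: "U j = tau2 j *\<^sub>R w j" for j by (simp add: U_def yh w_def algebra_simps)
  have V: "V j = tau2 j *\<^sub>R w (Suc j)" for j by (simp add: V_def yb w_def algebra_simps)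
  have \<mu>: "2 * \<rho>0 * (onorm B)\<^sup>2 \<le> \<mu> / 2"
    using \<rho>0 onorm_pos[OF B] by (simp add: field_simps)
  have \<mu>_mono: "2 * \<rho>0 * (onorm B)\<^sup>2 * c \<le> \<mu> / 2 * d" if "0 \<le> c" "c \<le> d" for c d
  proof (rule mult_mono[OF \<mu>])
    have "0 \<le> 2 * \<rho>0 * (onorm B)\<^sup>2" using \<rho>0(1) by simp
    then show "0 \<le> \<mu> / 2" using \<mu> by linarith
  qed (use that in auto)
  have tau1: "(tau2 1)\<^sup>2 = 1 - tau2 1" using tau2_facts(3)[of 0] by (simp del: tau2.simps(2))
  have \<rho>: "rho2 \<rho>0 j = \<rho>0 / (tau2 j)\<^sup>2" for j by (rule rho2_def)
  consider "k = 1" | "k = 2" | j where "k = Suc (j + 2)"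
    using k by (metis One_nat_def Suc_1 add_2_eq_Suc' not0_implies_Suc not_one_le_zero)
  then have "gap k \<le> (2 * L\<^sup>2 + 8 * \<rho>0\<^sup>2 * (onorm B)\<^sup>2 * (norm (w 0))\<^sup>2) / (\<rho>0 * (real k + 2)\<^sup>2)"
  proof cases
    case 1
    have "gap 1 \<le> (2 * \<bar>L\<bar>\<^sup>2 + 8 * (rho2 \<rho>0 0)\<^sup>2 * (onorm B)\<^sup>2 * (norm (U 0))\<^sup>2) / (9 * rho2 \<rho>0 0)"
    proof (rule gap_1_le)
      show "B (yb 1) \<in> effdom f" using mem 1 by simp
    qed (use \<mu>_mono in \<open>simp add: V \<rho> w_def\<close>)
    then show ?thesis by (simp add: 1 U \<rho> mult.commute)
  next
    case 2
    have "gap 2 \<le> (2 * \<bar>L\<bar>\<^sup>2 + 8 * (rho2 \<rho>0 0)\<^sup>2 * (onorm B)\<^sup>2 * (norm (U 0))\<^sup>2) / (16 * rho2 \<rho>0 0)"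
    proof (rule gap_2_le)
      show "B (yb 2) \<in> effdom f" using mem 2 by simp
      show "(tau2 1)\<^sup>2 = 1 - tau2 1" by (rule tau1)
      show "U 1 = tau2 1 *\<^sub>R V 0" unfolding U V by simp
      show "V 1 = tau2 1 *\<^sub>R w 2" unfolding V by (simp add: numeral_2_eq_2)
      have "yb 1 = yt 1" using yb[of 0] by simp
      then have eq: "yb 1 - yt (Suc 1) = V 0 - w 2" "yt (Suc 1) - ys = w 2"
        unfolding V by (simp_all add: w_def numeral_2_eq_2)
      have "2 * \<rho>0 * (onorm B)\<^sup>2 * (tau2 1 * ((norm (w 2))\<^sup>2 + (1 - tau2 1) * (norm (V 0 - w 2))\<^sup>2))
        \<le> \<mu> / 2 * (tau2 1 * ((norm (yt (Suc 1) - ys))\<^sup>2 + (1 - tau2 1) * (norm (yb 1 - yt (Suc 1)))\<^sup>2))"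
        unfolding eq using tau2_facts(1,2)[of 1] by (intro \<mu>_mono) (auto simp del: tau2.simps)
      then show "2 * rho2 \<rho>0 0 * (onorm B)\<^sup>2 * tau2 1 * ((norm (w 2))\<^sup>2 + (1 - tau2 1) * (norm (V 0 - w 2))\<^sup>2)
        \<le> \<mu> / 2 * (tau2 1 * ((norm (yt (Suc 1) - ys))\<^sup>2 + (1 - tau2 1) * (norm (yb 1 - yt (Suc 1)))\<^sup>2))"
        by (simp add: \<rho> mult.assoc del: tau2.simps(2))
    qed (use \<mu>_mono in \<open>simp add: V \<rho> w_def\<close>)
    then show ?thesis by (simp add: 2 U \<rho> mult.commute)
  next
    case (3 j)
    define t where "t = tau2 (j + 2)"
    have "gap k \<le> t\<^sup>2 * (\<rho>0 * (onorm B)\<^sup>2 * (norm (w 0))\<^sup>2 + \<bar>L\<bar>\<^sup>2 / (3 * \<rho>0))"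
      unfolding 3 t_def
    proof (rule gap_quadratic[OF tau2_facts(3,1,4) \<rho> U V])
      fix i
      have "2 * \<rho>0 * (onorm B)\<^sup>2 * (tau2 i * (norm (w (Suc i)))\<^sup>2)
        \<le> \<mu> / 2 * (tau2 i * ((norm (yt (Suc i) - ys))\<^sup>2 + (1 - tau2 i) * (norm (yb i - yt (Suc i)))\<^sup>2))"
        using tau2_facts(1,2)[of i] by (intro \<mu>_mono) (auto simp: w_def)
      then show "2 * \<rho>0 * (onorm B)\<^sup>2 * tau2 i * (norm (w (Suc i)))\<^sup>2
        \<le> \<mu> / 2 * (tau2 i * ((norm (yt (Suc i) - ys))\<^sup>2 + (1 - tau2 i) * (norm (yb i - yt (Suc i)))\<^sup>2))"
        by (simp add: mult.assoc)
      show "B (yb (Suc (j + 2))) \<in> effdom f" using mem 3 by simp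
    qed
    also have "\<dots> \<le> 6 / (real k + 2)\<^sup>2 * (\<rho>0 * (onorm B)\<^sup>2 * (norm (w 0))\<^sup>2 + \<bar>L\<bar>\<^sup>2 / (3 * \<rho>0))"
    proof (rule mult_right_mono)
      have "0 \<le> t * (42 / 100 * (real k + 2))" "t * (42 / 100 * (real k + 2)) \<le> 1"
        using tau2_upper_bound[of j] tau2_facts(1)[of "j + 2"] by (simp_all add: t_def 3 add_ac)
      then have "(t * (42 / 100 * (real k + 2)))\<^sup>2 \<le> 1\<^sup>2" by (intro power_mono) auto
      also have "(t * (42 / 100 * (real k + 2)))\<^sup>2 = 1764 / 10000 * (t\<^sup>2 * (real k + 2)\<^sup>2)"
        by (simp only: power_mult_distrib) (simp add: power2_eq_square)
      finally have "t\<^sup>2 * (real k + 2)\<^sup>2 \<le> 6" by simp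
      then show "t\<^sup>2 \<le> 6 / (real k + 2)\<^sup>2" by (simp add: pos_le_divide_eq)
    qed (use \<rho>0 in simp)
    also have "\<dots> \<le> 1 / (real k + 2)\<^sup>2 * (8 * \<rho>0 * (onorm B)\<^sup>2 * (norm (w 0))\<^sup>2 + 2 * L\<^sup>2 / \<rho>0)"
    proof -
      have "6 * (\<rho>0 * (onorm B)\<^sup>2 * (norm (w 0))\<^sup>2 + \<bar>L\<bar>\<^sup>2 / (3 * \<rho>0))
        \<le> 8 * \<rho>0 * (onorm B)\<^sup>2 * (norm (w 0))\<^sup>2 + 2 * L\<^sup>2 / \<rho>0"
        using \<rho>0 by (simp add: distrib_left mult.assoc)
      then show ?thesis by (simp add: divide_right_mono)
    qed
    also have "\<dots> = (2 * L\<^sup>2 + 8 * \<rho>0\<^sup>2 * (onorm B)\<^sup>2 * (norm (w 0))\<^sup>2) / (\<rho>0 * (real k + 2)\<^sup>2)"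
      using \<rho>0 by (simp add: add_divide_distrib distrib_left power2_eq_square[of \<rho>0] mult_ac)
    finally show ?thesis .
  qed
  moreover have "w 0 = yb 0 - ys" by (simp add: w_def yt0)
  ultimately show ?thesis
    unfolding objective_diff_eq[of f g B, OF f(1) g(1) mem yb_dom ys] by (simp add: gap_def)
qed

theorem theorem6p1:
  fixes f :: "real ^ 'n \<Rightarrow> ereal" and g :: "real ^ 'p \<Rightarrow> ereal"
    and B :: "real ^ 'p \<Rightarrow> real ^ 'n" and L\<^sub>f :: real and ystar :: "real ^ 'p"
  assumes f: "proper f" "closed_fun f" "convex_fun f"
    and g: "proper g" "closed_fun g" "convex_fun g"
    and B: "linear B" "B \<noteq> (\<lambda>y. 0)"
    and saddle: "has_saddle_point f g B"
    and value_finite: "optimal_value_finite_attained f g B"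
    and Lip: "lipschitz_on_dom L\<^sub>f f"
    and ystar: "\<And>y. objective f g B ystar \<le> objective f g B y"
  shows
    "(\<forall>\<rho>0 xc xb yb yh lh.
        \<rho>0 > 0 \<longrightarrow> scheme1 f g B \<rho>0 xc xb yb yh lh \<longrightarrow>
        (\<forall>k\<ge>1. B (yb k) \<in> effdom f \<longrightarrow>
          objective f g B (yb k) - objective f g B ystar
            \<le> ereal ((2 * \<rho>0\<^sup>2 * (onorm B)\<^sup>2 * (norm (yb 0 - ystar))\<^sup>2 + 2 * L\<^sub>f\<^sup>2) / (\<rho>0 * real k))))
     \<and>
     (\<forall>\<mu>\<^sub>g \<rho>0 xc xb yb yh yt lh.
        \<mu>\<^sub>g > 0 \<longrightarrow> strongly_convex_fun \<mu>\<^sub>g g \<longrightarrow>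
        0 < \<rho>0 \<longrightarrow> \<rho>0 \<le> \<mu>\<^sub>g / (4 * (onorm B)\<^sup>2) \<longrightarrow>
        scheme2 f g B \<rho>0 xc xb yb yh yt lh \<longrightarrow>
        (\<forall>k\<ge>1. B (yb k) \<in> effdom f \<longrightarrow>
          objective f g B (yb k) - objective f g B ystar
            \<le> ereal ((2 * L\<^sub>f\<^sup>2 + 8 * \<rho>0\<^sup>2 * (onorm B)\<^sup>2 * (norm (yb 0 - ystar))\<^sup>2)
                / (\<rho>0 * (real k + 2)\<^sup>2))))"
proof (intro conjI allI impI)
  note dom = optimal_point_effdom[OF f(1) g(1) value_finite ystar]
  fix \<rho>0 xc xb yb yh lh and k :: nat
  assume "\<rho>0 > 0" "scheme1 f g B \<rho>0 xc xb yb yh lh" "k \<ge> 1" "B (yb k) \<in> effdom f"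
  then show "objective f g B (yb k) - objective f g B ystar
      \<le> ereal ((2 * \<rho>0\<^sup>2 * (onorm B)\<^sup>2 * (norm (yb 0 - ystar))\<^sup>2 + 2 * L\<^sub>f\<^sup>2) / (\<rho>0 * real k))"
    by (rule scheme1_bound[OF f g B Lip dom])
next
  note dom = optimal_point_effdom[OF f(1) g(1) value_finite ystar]
  fix \<mu>\<^sub>g \<rho>0 xc xb yb yh yt lh and k :: nat
  assume "\<mu>\<^sub>g > 0" and sc: "strongly_convex_fun \<mu>\<^sub>g g"
    and *: "0 < \<rho>0" "\<rho>0 \<le> \<mu>\<^sub>g / (4 * (onorm B)\<^sup>2)"
      "scheme2 f g B \<rho>0 xc xb yb yh yt lh" "1 \<le> k" "B (yb k) \<in> effdom f"
  show "objective f g B (yb k) - objective f g B ystar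
      \<le> ereal ((2 * L\<^sub>f\<^sup>2 + 8 * \<rho>0\<^sup>2 * (onorm B)\<^sup>2 * (norm (yb 0 - ystar))\<^sup>2)
          / (\<rho>0 * (real k + 2)\<^sup>2))"
    using * by (rule scheme2_bound[OF f g sc B Lip dom])
qed

end
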